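(* Let $1<p<\infty$ and let $\theta$ be an inner function in the upper half-plane. Then $K_\theta^p\subset H_\infty^+$ if and only if $$\sup_{w\in\mathbb{C}^+}\frac{1-|\theta(w)|^2}{\operatorname{Im} w}<\infty .$$
   Context: $\mathbb{C}^+$ and $\mathbb{C}^-$ are the open upper and lower half-planes. $H_p^\pm=H^p(\mathbb{C}^\pm)$ are the Hardy spaces of the upper/lower half-plane, identified via boundary values with closed subspaces of $L_p=L^p(\mathbb{R})$, and $H_\infty^\pm=H^\infty(\mathbb{C}^\pm)$. An inner function is a function $\theta\in H_\infty^+$ with $|\theta|=1$ a.e. on $\mathbb{R}$. The model space is $K_\theta^p:=H_p^+\cap\theta H_p^-$. *)

theory Defs
  imports "HOL-Complex_Analysis.Complex_Analysis"
begin

definition upper_half_plane :: "complex set" where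
  "upper_half_plane = {z. 0 < Im z}"

definition lower_half_plane :: "complex set" where
  "lower_half_plane = {z. Im z < 0}"

text \<open>Lebesgue spaces on the real line. Elements are functions rather than classes modulo
  null sets; every set of functions on the line below is closed under equality almost everywhere.\<close>

definition Lp_space :: "real \<Rightarrow> (real \<Rightarrow> complex) set" where
  "Lp_space p = {f \<in> borel_measurable lebesgue.
     (\<integral>\<^sup>+ x. ennreal (norm (f x) powr p) \<partial>lebesgue) < \<infinity>}"

definition Linf_space :: "(real \<Rightarrow> complex) set" where
  "Linf_space = {f \<in> borel_measurable lebesgue. \<exists>C. AE x in lebesgue. norm (f x) \<le> C}"

text \<open>Hardy spaces as spaces of holomorphic functions on a half-plane; values outside the
  half-plane are irrelevant.\<close>

definition hardy_upper :: "real \<Rightarrow> (complex \<Rightarrow> complex) set" where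
  "hardy_upper p = {F. F holomorphic_on upper_half_plane \<and>
     (SUP y\<in>{0<..}. \<integral>\<^sup>+ x. ennreal (norm (F (Complex x y)) powr p) \<partial>lebesgue) < \<infinity>}"

definition hardy_lower :: "real \<Rightarrow> (complex \<Rightarrow> complex) set" where
  "hardy_lower p = {F. F holomorphic_on lower_half_plane \<and>
     (SUP y\<in>{..<0}. \<integral>\<^sup>+ x. ennreal (norm (F (Complex x y)) powr p) \<partial>lebesgue) < \<infinity>}"

definition hardy_inf_upper :: "(complex \<Rightarrow> complex) set" where
  "hardy_inf_upper = {F. F holomorphic_on upper_half_plane \<and> bounded (F ` upper_half_plane)}"

text \<open>Boundary values are vertical limits, existing almost everywhere. By Fatou's theorem, for
  functions in Hardy spaces they coincide almost everywhere with the non-tangential limits.\<close>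

definition upper_boundary_values :: "(complex \<Rightarrow> complex) \<Rightarrow> (real \<Rightarrow> complex) \<Rightarrow> bool" where
  "upper_boundary_values F f \<longleftrightarrow>
     (AE x in lebesgue. ((\<lambda>y. F (Complex x y)) \<longlongrightarrow> f x) (at_right 0))"

definition lower_boundary_values :: "(complex \<Rightarrow> complex) \<Rightarrow> (real \<Rightarrow> complex) \<Rightarrow> bool" where
  "lower_boundary_values F f \<longleftrightarrow>
     (AE x in lebesgue. ((\<lambda>y. F (Complex x y)) \<longlongrightarrow> f x) (at_left 0))"

text \<open>The Hardy spaces identified with subspaces of the Lebesgue spaces on the line.\<close>

definition Hp_plus :: "real \<Rightarrow> (real \<Rightarrow> complex) set" where
  "Hp_plus p = {f \<in> Lp_space p. \<exists>F\<in>hardy_upper p. upper_boundary_values F f}"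

definition Hp_minus :: "real \<Rightarrow> (real \<Rightarrow> complex) set" where
  "Hp_minus p = {f \<in> Lp_space p. \<exists>F\<in>hardy_lower p. lower_boundary_values F f}"

definition Hinf_plus :: "(real \<Rightarrow> complex) set" where
  "Hinf_plus = {f \<in> Linf_space. \<exists>F\<in>hardy_inf_upper. upper_boundary_values F f}"

definition inner_function :: "(complex \<Rightarrow> complex) \<Rightarrow> bool" where
  "inner_function \<theta> \<longleftrightarrow> \<theta> \<in> hardy_inf_upper \<and>
     (\<exists>u. upper_boundary_values \<theta> u \<and> (AE x in lebesgue. norm (u x) = 1))"

text \<open>Pointwise products of the boundary function of \<open>\<theta>\<close> (unique up to null sets) with
  functions in \<open>X\<close>.\<close>

definition boundary_mult :: "(complex \<Rightarrow> complex) \<Rightarrow> (real \<Rightarrow> complex) set \<Rightarrow> (real \<Rightarrow> complex) set"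
  where "boundary_mult \<theta> X = {f. \<exists>u h. upper_boundary_values \<theta> u \<and> h \<in> X \<and>
     (AE x in lebesgue. f x = u x * h x)}"

definition model_space :: "real \<Rightarrow> (complex \<Rightarrow> complex) \<Rightarrow> (real \<Rightarrow> complex) set" where
  "model_space p \<theta> = Hp_plus p \<inter> boundary_mult \<theta> (Hp_minus p)"

end

theory Submission
  imports Defs
begin

text \<open>
  Write \<open>q = p / (p - 1)\<close>. Everything rests on Cauchy's formula
  \<open>\<integral> f t / (t - z) dt = 2 \<pi> i F z\<close> for \<open>Im z > 0\<close>, and \<open>= 0\<close> for \<open>Im z < 0\<close>, where \<open>F\<close> is in
  the Hardy space of exponent \<open>p\<close> with boundary function \<open>f\<close> (\<open>Cauchy_integral_hardy\<close>).

  If \<open>1 - |\<theta> w|\<^sup>2 \<le> C Im w\<close>, then \<open>|\<theta>| \<ge> 1/2\<close> in a strip \<open>0 < Im w < \<beta>\<close>. Let \<open>f = u h\<close> be in the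
  model space, with \<open>u\<close> the boundary function of \<open>\<theta>\<close>, \<open>F\<close> the extension of \<open>f\<close> to the upper and
  \<open>H\<close> that of \<open>h\<close> to the lower half-plane. Because \<open>|u| = 1\<close>, the function
  \<open>G z = cnj (H (cnj z)) / \<theta> z\<close> on the strip has boundary function \<open>cnj f\<close>, and its \<open>L\<^sup>p\<close> norms on
  horizontal lines are bounded. In the conjugate of the Cauchy formula for \<open>F z\<close> the kernel
  \<open>1 / (t - cnj z)\<close> is regular in the upper half-plane, so the line of integration can be raised to
  height \<open>\<beta> / 2\<close>. There the kernel has \<open>L\<^sup>q\<close> norm bounded independently of \<open>z\<close>, hence \<open>F\<close> is
  bounded (\<open>model_space_subset_Hinf_plus_if_bounded\<close>).

  Conversely suppose that \<open>(1 - |\<theta> w|\<^sup>2) / Im w\<close> is unbounded, and consider the functions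
  \<open>k\<^sub>w z = (1 - cnj (\<theta> w) \<theta> z) / (z - cnj w)\<close>. Since \<open>k\<^sub>w w\<close> has modulus
  \<open>(1 - |\<theta> w|\<^sup>2) / (2 Im w)\<close>, the sup norms \<open>N\<^sub>w\<close> of the \<open>k\<^sub>w\<close> are unbounded. On the other hand
  \<open>|k\<^sub>w (t + i s)|\<close> is at most both \<open>N\<^sub>w\<close> and \<open>2 / |t - Re w|\<close>, so on every horizontal line it is
  dominated by one function of \<open>t\<close> with \<open>L\<^sup>p\<close> norm at most a constant times \<open>N\<^sub>w powr (1/q)\<close>,
  which is much smaller than \<open>N\<^sub>w\<close>. A gliding hump (\<open>gliding_hump\<close>) then gives points \<open>w\<^sub>n\<close> and weights
  \<open>c\<^sub>n = N\<^sub>n powr (- 1/q) / 4 ^ n\<close> for which \<open>\<Sum> c\<^sub>n k\<^sub>w\<^sub>n\<close> is unbounded in the half-plane. The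
  domination is uniform in the height, so the series converges in the Hardy space and keeps its
  vertical limits (\<open>hardy_upper_series\<close>). The factor in the lower half-plane
  comes in the same way from the difference quotients \<open>(\<theta> z - \<theta> w) / (z - w)\<close>, which the
  Schwarz-Pick inequality bounds by \<open>|k\<^sub>w z|\<close>. Thus the sum lies in the model space. Were its
  boundary function bounded, the difference of Cauchy's formulas at \<open>z\<close> and \<open>cnj z\<close>, which is
  Poisson's formula, would bound the sum itself (\<open>hardy_bounded_by_boundary_values\<close>).
\<close>

section \<open>Weak convergence in Lebesgue spaces\<close>

text \<open>The weight \<open>\<epsilon>\<close> on the first term makes the contribution of a
  factor that is merely bounded in \<open>L\<^sup>p\<close> negligible; the price is paid by the
  fixed or decaying factor in \<open>L\<^sup>q\<close>. In this form the inequality replaces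
  Hoelder's inequality throughout.\<close>

lemma Young_scaled:
  fixes p \<epsilon> :: real
  assumes p: "1 < p" and \<epsilon>: "0 < \<epsilon>"
  obtains C where "0 < C"
    "\<And>a b. \<lbrakk>0 \<le> a; 0 \<le> b\<rbrakk> \<Longrightarrow> a * b \<le> \<epsilon> * a powr p + C * b powr (p / (p - 1))"
proof
  define C where "C = (1 / \<epsilon>) powr (1 / (p - 1))"
  show "0 < C" using \<epsilon> by (simp add: C_def)
  fix a b :: real assume a: "0 \<le> a" and b: "0 \<le> b"
  show "a * b \<le> \<epsilon> * a powr p + C * b powr (p / (p - 1))"
  \<comment> \<open>Below the curve \<open>b = \<epsilon> a powr (p - 1)\<close> the first term
    alone is large enough, above it the second.\<close>
  proof (cases "b \<le> \<epsilon> * a powr (p - 1)")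
    case True
    have "a * b \<le> a * (\<epsilon> * a powr (p - 1))" by (rule mult_left_mono[OF True a])
    also have "\<dots> = \<epsilon> * a powr p" using a by (cases "a = 0") (auto simp: powr_diff)
    finally show ?thesis using \<open>0 < C\<close> by (smt (verit) mult_nonneg_nonneg powr_ge_zero)
  next
    case False
    then have "a powr (p - 1) \<le> b / \<epsilon>" using \<epsilon> by (simp add: field_simps)
    then have "(a powr (p - 1)) powr (1 / (p - 1)) \<le> (b / \<epsilon>) powr (1 / (p - 1))"
      using p by (intro powr_mono2) auto
    then have "a \<le> (b / \<epsilon>) powr (1 / (p - 1))" using p a by (simp add: powr_powr)
    also have "\<dots> = C * b powr (1 / (p - 1))"
      using b \<epsilon> powr_mult[of b "1/\<epsilon>" "1/(p-1)"] by (simp add: C_def field_simps)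
    finally have "a * b \<le> C * b powr (1 / (p - 1)) * b" by (rule mult_right_mono[OF _ b])
    also have "\<dots> = C * b powr (p / (p - 1))"
    proof -
      have "p / (p - 1) = 1 / (p - 1) + 1" using p by (simp add: field_simps)
      then show ?thesis using b by (cases "b = 0") (auto simp: powr_add)
    qed
    finally show ?thesis using \<epsilon> by (smt (verit) mult_nonneg_nonneg powr_ge_zero)
  qed
qed

lemma Lp_space_iff:
  "f \<in> Lp_space p \<longleftrightarrow> f \<in> borel_measurable lebesgue \<and> integrable lebesgue (\<lambda>x. norm (f x) powr p)"
  unfolding Lp_space_def by (auto simp: integrable_iff_bounded)

lemma nn_integral_norm_powr_Lp:
  assumes "f \<in> Lp_space p"
  shows "(\<integral>\<^sup>+x. ennreal (norm (f x) powr p) \<partial>lebesgue) = ennreal (\<integral>x. norm (f x) powr p \<partial>lebesgue)"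
  using assms by (intro nn_integral_eq_integral) (auto simp: Lp_space_iff)

lemma Lp_space_bounded_by:
  assumes f: "f \<in> borel_measurable lebesgue"
    and le: "(\<integral>\<^sup>+x. ennreal (norm (f x) powr p) \<partial>lebesgue) \<le> ennreal M" and M: "0 \<le> M"
  shows "f \<in> Lp_space p" "(\<integral>x. norm (f x) powr p \<partial>lebesgue) \<le> M"
proof -
  show *: "f \<in> Lp_space p" using f le by (auto simp: Lp_space_def intro: le_less_trans)
  show "(\<integral>x. norm (f x) powr p \<partial>lebesgue) \<le> M"
    using le M unfolding nn_integral_norm_powr_Lp[OF *] by simp
qed

lemma powr_norm_add_le:
  fixes a b :: "'a :: real_normed_vector"
  assumes "0 < p"
  shows "norm (a + b) powr p \<le> 2 powr p * (norm a powr p + norm b powr p)"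
proof -
  have "norm (a + b) \<le> 2 * max (norm a) (norm b)" using norm_triangle_ineq[of a b] by linarith
  then have "norm (a + b) powr p \<le> (2 * max (norm a) (norm b)) powr p"
    using assms by (intro powr_mono2) auto
  also have "\<dots> = 2 powr p * max (norm a) (norm b) powr p" by (simp add: powr_mult)
  also have "\<dots> \<le> 2 powr p * (norm a powr p + norm b powr p)"
    by (intro mult_left_mono) (auto simp: max_def)
  finally show ?thesis .
qed

lemma integrable_mult_Lp:
  fixes f g :: "real \<Rightarrow> complex"
  assumes p: "1 < p" and f: "f \<in> Lp_space p" and g: "g \<in> Lp_space (p / (p - 1))"
  shows "integrable lebesgue (\<lambda>x. f x * g x)"
proof -
  have [measurable]: "f \<in> borel_measurable lebesgue" "g \<in> borel_measurable lebesgue"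
    using f g by (auto simp: Lp_space_def)
  obtain C where C: "0 < C"
    "\<And>a b. \<lbrakk>0 \<le> a; 0 \<le> b\<rbrakk> \<Longrightarrow> a * b \<le> 1 * a powr p + C * b powr (p / (p - 1))"
    using Young_scaled[OF p, of 1] by (metis zero_less_one)
  have "integrable lebesgue (\<lambda>x. 1 * norm (f x) powr p + C * norm (g x) powr (p / (p - 1)))"
    using f g by (auto simp: Lp_space_iff)
  then show ?thesis
  proof (rule Bochner_Integration.integrable_bound)
    show "AE x in lebesgue. norm (f x * g x) \<le> norm (1 * norm (f x) powr p + C * norm (g x) powr (p / (p - 1)))"
      using C(2)[of "norm (f _)" "norm (g _)"] by (intro AE_I2) (smt (verit) norm_ge_zero norm_mult real_norm_def)
  qed measurable
qed

lemma norm_integral_mult_Lp_le: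
  fixes f g :: "real \<Rightarrow> complex"
  assumes p: "1 < p" and f: "f \<in> Lp_space p" and g: "g \<in> Lp_space (p / (p - 1))"
    and C: "\<And>a b. \<lbrakk>0 \<le> a; 0 \<le> b\<rbrakk> \<Longrightarrow> a * b \<le> \<epsilon> * a powr p + C * b powr (p / (p - 1))"
  shows "norm (\<integral>x. f x * g x \<partial>lebesgue) \<le>
    \<epsilon> * (\<integral>x. norm (f x) powr p \<partial>lebesgue) + C * (\<integral>x. norm (g x) powr (p / (p - 1)) \<partial>lebesgue)"
proof -
  have "norm (\<integral>x. f x * g x \<partial>lebesgue) \<le> (\<integral>x. norm (f x * g x) \<partial>lebesgue)"
    by (rule integral_norm_bound)
  also have "\<dots> \<le> (\<integral>x. \<epsilon> * norm (f x) powr p + C * norm (g x) powr (p / (p - 1)) \<partial>lebesgue)"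
  proof (rule integral_mono)
    show "integrable lebesgue (\<lambda>x. norm (f x * g x))"
      using integrable_mult_Lp[OF p f g] by (rule integrable_norm)
    show "norm (f x * g x) \<le> \<epsilon> * norm (f x) powr p + C * norm (g x) powr (p / (p - 1))" for x
      using C[of "norm (f x)" "norm (g x)"] by (simp add: norm_mult)
  qed (use f g in \<open>auto simp: Lp_space_iff\<close>)
  also have "\<dots> = \<epsilon> * (\<integral>x. norm (f x) powr p \<partial>lebesgue) + C * (\<integral>x. norm (g x) powr (p / (p - 1)) \<partial>lebesgue)"
    using f g by (subst Bochner_Integration.integral_add) (auto simp: Lp_space_iff)
  finally show ?thesis .
qed

lemma Lp_space_diff:
  fixes f g :: "real \<Rightarrow> complex"
  assumes p: "0 < p" and f: "f \<in> Lp_space p" and g: "g \<in> Lp_space p"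
  shows "(\<lambda>x. f x - g x) \<in> Lp_space p"
    "(\<integral>x. norm (f x - g x) powr p \<partial>lebesgue) \<le>
      2 powr p * ((\<integral>x. norm (f x) powr p \<partial>lebesgue) + (\<integral>x. norm (g x) powr p \<partial>lebesgue))"
proof -
  have [measurable]: "f \<in> borel_measurable lebesgue" "g \<in> borel_measurable lebesgue"
    using f g by (auto simp: Lp_space_def)
  have le: "norm (f x - g x) powr p \<le> 2 powr p * (norm (f x) powr p + norm (g x) powr p)" for x
    using powr_norm_add_le[OF p, of "f x" "- g x"] by simp
  have int: "integrable lebesgue (\<lambda>x. 2 powr p * (norm (f x) powr p + norm (g x) powr p))"
    using f g by (auto simp: Lp_space_iff)
  have *: "integrable lebesgue (\<lambda>x. norm (f x - g x) powr p)"
    by (rule Bochner_Integration.integrable_bound[OF int]) (auto intro!: AE_I2 order_trans[OF le])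
  then show "(\<lambda>x. f x - g x) \<in> Lp_space p" by (simp add: Lp_space_iff)
  have "(\<integral>x. norm (f x - g x) powr p \<partial>lebesgue) \<le> (\<integral>x. 2 powr p * (norm (f x) powr p + norm (g x) powr p) \<partial>lebesgue)"
    by (intro integral_mono * int le)
  also have "\<dots> = 2 powr p * ((\<integral>x. norm (f x) powr p \<partial>lebesgue) + (\<integral>x. norm (g x) powr p \<partial>lebesgue))"
    using f g by (simp add: Lp_space_iff)
  finally show "(\<integral>x. norm (f x - g x) powr p \<partial>lebesgue) \<le>
      2 powr p * ((\<integral>x. norm (f x) powr p \<partial>lebesgue) + (\<integral>x. norm (g x) powr p \<partial>lebesgue))" .
qed

text \<open>For \<open>p > 1\<close> a bounded sequence in \<open>L\<^sup>p\<close> that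
  converges almost everywhere converges weakly. With \<open>D\<^sub>n = F\<^sub>n - f\<close> the
  scaled Young inequality gives \<open>|D\<^sub>n g| \<le> min |D\<^sub>n g| (C |g|\<^sup>q) +
  \<epsilon> |D\<^sub>n|\<^sup>p\<close>; the minimum tends to \<open>0\<close> in
  \<open>L\<^sup>1\<close> by dominated convergence, and the rest has integral at most a constant
  times \<open>\<epsilon>\<close>. This is what connects values on interior lines with boundary
  values that exist only as vertical limits.\<close>

lemma Lp_bounded_AE_limit_weak:
  fixes F :: "nat \<Rightarrow> real \<Rightarrow> complex"
  assumes p: "1 < p" and F: "\<And>n. F n \<in> Lp_space p" and f: "f \<in> Lp_space p"
    and g: "g \<in> Lp_space (p / (p - 1))"
    and M: "\<And>n. (\<integral>x. norm (F n x) powr p \<partial>lebesgue) \<le> M"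
    and lim: "AE x in lebesgue. (\<lambda>n. F n x) \<longlonglongrightarrow> f x"
  shows "(\<lambda>n. \<integral>x. F n x * g x \<partial>lebesgue) \<longlonglongrightarrow> (\<integral>x. f x * g x \<partial>lebesgue)"
proof (rule LIMSEQ_I)
  fix r :: real assume r: "0 < r"
  define M' where "M' = 2 powr p * (M + (\<integral>x. norm (f x) powr p \<partial>lebesgue))"
  have [measurable]: "\<And>n. F n \<in> borel_measurable lebesgue" "f \<in> borel_measurable lebesgue"
      "g \<in> borel_measurable lebesgue"
    using F f g by (auto simp: Lp_space_def)
  define D where "D n x = F n x - f x" for n x
  have D: "D n \<in> Lp_space p" for n
    using Lp_space_diff(1)[of p "F n" f] F f p by (simp add: D_def[abs_def])
  have DM: "(\<integral>x. norm (D n x) powr p \<partial>lebesgue) \<le> M'" for n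
  proof -
    have "(\<integral>x. norm (D n x) powr p \<partial>lebesgue) \<le> 2 powr p * ((\<integral>x. norm (F n x) powr p \<partial>lebesgue) + (\<integral>x. norm (f x) powr p \<partial>lebesgue))"
      using Lp_space_diff(2)[of p "F n" f] F f p by (simp add: D_def)
    also have "\<dots> \<le> M'" unfolding M'_def using M by (intro mult_left_mono) auto
    finally show ?thesis .
  qed
  have "0 \<le> (\<integral>x. norm (D 0 x) powr p \<partial>lebesgue)" by (rule integral_nonneg_AE) auto
  then have M'0: "0 \<le> M'" using DM[of 0] by linarith
  define \<epsilon> where "\<epsilon> = r / (2 * (M' + 1))"
  have \<epsilon>: "0 < \<epsilon>" "\<epsilon> * M' < r / 2" using r M'0 by (auto simp: \<epsilon>_def field_simps)
  obtain C where C: "0 < C"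
    "\<And>a b. \<lbrakk>0 \<le> a; 0 \<le> b\<rbrakk> \<Longrightarrow> a * b \<le> \<epsilon> * a powr p + C * b powr (p / (p - 1))"
    using Young_scaled[OF p \<epsilon>(1)] by blast
  have gq: "integrable lebesgue (\<lambda>x. C * norm (g x) powr (p / (p - 1)))"
    using g by (auto simp: Lp_space_iff)
  define m where "m n x = min (norm (D n x * g x)) (C * norm (g x) powr (p / (p - 1)))" for n x
  have "(\<lambda>n. \<integral>x. m n x \<partial>lebesgue) \<longlonglongrightarrow> (\<integral>x. 0 \<partial>(lebesgue :: real measure))"
  proof (rule integral_dominated_convergence[where w = "\<lambda>x. C * norm (g x) powr (p / (p - 1))"])
    show "integrable lebesgue (\<lambda>x. C * norm (g x) powr (p / (p - 1)))" by (rule gq)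
    show "AE x in lebesgue. (\<lambda>n. m n x) \<longlonglongrightarrow> 0"
      using lim
    proof eventually_elim
      case (elim x)
      then have "(\<lambda>n. min (norm ((F n x - f x) * g x)) (C * norm (g x) powr (p / (p - 1)))) \<longlonglongrightarrow>
         min (norm ((f x - f x) * g x)) (C * norm (g x) powr (p / (p - 1)))"
        by (intro tendsto_intros)
      then show ?case using C(1) by (simp add: m_def D_def)
    qed
  qed (use C(1) in \<open>auto simp: m_def[abs_def] D_def[abs_def] intro!: AE_I2\<close>)
  then have "(\<lambda>n. \<integral>x. m n x \<partial>lebesgue) \<longlonglongrightarrow> 0" by simp
  from LIMSEQ_D[OF this, of "r/2"] r obtain n0 where
    n0: "\<And>n. n \<ge> n0 \<Longrightarrow> norm ((\<integral>x. m n x \<partial>lebesgue) - 0) < r / 2" by auto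
  show "\<exists>n0. \<forall>n\<ge>n0. norm ((\<integral>x. F n x * g x \<partial>lebesgue) - (\<integral>x. f x * g x \<partial>lebesgue)) < r"
  proof (intro exI allI impI)
    fix n assume "n \<ge> n0"
    have mi: "integrable lebesgue (m n)"
      by (rule Bochner_Integration.integrable_bound[OF gq])
         (use C(1) in \<open>auto simp: m_def[abs_def] D_def[abs_def] intro!: AE_I2\<close>)
    have Dp: "integrable lebesgue (\<lambda>x. \<epsilon> * norm (D n x) powr p)" using D[of n] by (simp add: Lp_space_iff)
    have "(\<integral>x. F n x * g x \<partial>lebesgue) - (\<integral>x. f x * g x \<partial>lebesgue) = (\<integral>x. D n x * g x \<partial>lebesgue)"
      using integrable_mult_Lp[OF p F g] integrable_mult_Lp[OF p f g]
      by (simp add: D_def algebra_simps flip: Bochner_Integration.integral_diff)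
    then have "norm ((\<integral>x. F n x * g x \<partial>lebesgue) - (\<integral>x. f x * g x \<partial>lebesgue)) \<le> (\<integral>x. norm (D n x * g x) \<partial>lebesgue)"
      by simp
    also have "\<dots> \<le> (\<integral>x. m n x + \<epsilon> * norm (D n x) powr p \<partial>lebesgue)"
    proof (rule integral_mono)
      show "integrable lebesgue (\<lambda>x. norm (D n x * g x))"
        using integrable_mult_Lp[OF p D g] by (rule integrable_norm)
      show "integrable lebesgue (\<lambda>x. m n x + \<epsilon> * norm (D n x) powr p)" using mi Dp by simp
      show "norm (D n x * g x) \<le> m n x + \<epsilon> * norm (D n x) powr p" for x
        using C(2)[of "norm (D n x)" "norm (g x)"] \<epsilon>(1)
        by (auto simp: m_def min_def norm_mult)
    qed
    also have "\<dots> = (\<integral>x. m n x \<partial>lebesgue) + \<epsilon> * (\<integral>x. norm (D n x) powr p \<partial>lebesgue)"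
      using mi Dp by (subst Bochner_Integration.integral_add) auto
    also have "\<dots> < r / 2 + r / 2"
      using n0[OF \<open>n \<ge> n0\<close>] \<epsilon> mult_left_mono[OF DM[of n], of \<epsilon>]
      unfolding diff_0_right real_norm_def by linarith
    finally show "norm ((\<integral>x. F n x * g x \<partial>lebesgue) - (\<integral>x. f x * g x \<partial>lebesgue)) < r" by simp
  qed
qed

section \<open>A scale of majorants\<close>

text \<open>Up to constant factors, \<open>bump N x\<close> is the minimum of \<open>N\<close>
  and \<open>1 / |t - x|\<close>. The quotient has the advantage that scaling and translation
  reduce it to the single function \<open>bump 1 0\<close>.\<close>

definition bump :: "real \<Rightarrow> real \<Rightarrow> real \<Rightarrow> real" where
  "bump N x t = N / (1 + N * \<bar>t - x\<bar>)"

lemma bump_pos: "0 < N \<Longrightarrow> 0 < bump N x t"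
  by (auto simp: bump_def intro!: divide_pos_pos add_pos_nonneg)

lemma measurable_bump [measurable]: "bump N x \<in> borel_measurable borel"
  unfolding bump_def[abs_def] by measurable

lemma unit_bump_powr_finite:
  assumes p: "1 < p"
  shows "(\<integral>\<^sup>+t. ennreal (bump 1 0 t powr p) \<partial>lborel) < \<infinity>"
proof -
  define \<phi> where "\<phi> t = (1 + t) powr (- p)" for t :: real
  have half: "(\<integral>\<^sup>+t. ennreal (\<phi> t) * indicator {0..} t \<partial>lborel) = ennreal (0 - (1 + 0) powr (1 - p) / (1 - p))"
  proof (rule nn_integral_FTC_atLeast)
    show "((\<lambda>x. (1 + x) powr (1 - p) / (1 - p)) has_real_derivative \<phi> x) (at x)" if "0 \<le> x" for x
    proof -
      have "((\<lambda>x. (1 + x) powr (1 - p)) has_real_derivative (1 - p) * (1 + x) powr (1 - p - 1)) (at x)"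
        using that by (auto intro!: derivative_eq_intros)
      from DERIV_cdivide[OF this, of "1 - p"] show ?thesis using p by (simp add: \<phi>_def)
    qed
    have "((\<lambda>x. (1 + x) powr (1 - p)) \<longlongrightarrow> 0) at_top"
      using p by (intro tendsto_neg_powr filterlim_tendsto_add_at_top[OF tendsto_const]) (auto simp: filterlim_ident)
    then show "((\<lambda>x. (1 + x) powr (1 - p) / (1 - p)) \<longlongrightarrow> 0) at_top"
      using tendsto_divide_zero by blast
  qed (auto simp: \<phi>_def)
  have neg: "(\<integral>\<^sup>+t. ennreal (\<phi> (- t)) * indicator {..0} t \<partial>lborel) = (\<integral>\<^sup>+t. ennreal (\<phi> t) * indicator {0..} t \<partial>lborel)"
    by (subst nn_integral_real_affine[where c = "-1" and t = 0])
       (auto simp: \<phi>_def indicator_def intro!: nn_integral_cong)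
  have "(\<integral>\<^sup>+t. ennreal (bump 1 0 t powr p) \<partial>lborel) \<le>
    (\<integral>\<^sup>+t. ennreal (\<phi> t) * indicator {0..} t + ennreal (\<phi> (- t)) * indicator {..0} t \<partial>lborel)"
  proof (rule nn_integral_mono)
    fix t :: real
    have "bump 1 0 t powr p = (1 + \<bar>t\<bar>) powr (- p)"
      by (simp add: bump_def powr_minus_divide powr_divide)
    then show "ennreal (bump 1 0 t powr p) \<le> ennreal (\<phi> t) * indicator {0..} t + ennreal (\<phi> (- t)) * indicator {..0} t"
      by (cases "0 \<le> t") (auto simp: \<phi>_def indicator_def intro: add_increasing2)
  qed
  also have "\<dots> = (\<integral>\<^sup>+t. ennreal (\<phi> t) * indicator {0..} t \<partial>lborel) + (\<integral>\<^sup>+t. ennreal (\<phi> (- t)) * indicator {..0} t \<partial>lborel)"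
    by (intro nn_integral_add) (auto simp: \<phi>_def)
  also have "\<dots> < \<infinity>" unfolding neg half by (simp add: ennreal_add_eq_top less_top[symmetric])
  finally show ?thesis .
qed

definition bump_mass :: "real \<Rightarrow> real" where
  "bump_mass p = enn2real (\<integral>\<^sup>+t. ennreal (bump 1 0 t powr p) \<partial>lborel)"

lemma bump_mass_nonneg: "0 \<le> bump_mass p" by (simp add: bump_mass_def)

lemma nn_integral_bump:
  assumes p: "1 < p" and N: "0 < N"
  shows "(\<integral>\<^sup>+t. ennreal (bump N x t powr p) \<partial>lebesgue) = ennreal (N powr (p - 1) * bump_mass p)"
proof -
  have "(\<integral>\<^sup>+t. ennreal (bump N x t powr p) \<partial>lebesgue) = (\<integral>\<^sup>+t. ennreal (bump N x t powr p) \<partial>lborel)"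
    by (rule nn_integral_completion)
  also have "\<dots> = ennreal (1 / N) * (\<integral>\<^sup>+t. ennreal (bump N x (x + 1 / N * t) powr p) \<partial>lborel)"
    using N by (subst nn_integral_real_affine[where c = "1 / N" and t = x]) auto
  also have "\<dots> = ennreal (1 / N) * (\<integral>\<^sup>+t. ennreal (N powr p) * ennreal (bump 1 0 t powr p) \<partial>lborel)"
    using N by (simp add: bump_def powr_divide abs_mult flip: ennreal_mult)
  also have "\<dots> = ennreal (1 / N) * (ennreal (N powr p) * ennreal (bump_mass p))"
    using unit_bump_powr_finite[OF p] by (subst nn_integral_cmult) (auto simp: bump_mass_def less_top)
  also have "\<dots> = ennreal (1 / N * (N powr p * bump_mass p))"
    using N by (simp add: bump_mass_nonneg flip: ennreal_mult)
  also have "1 / N * (N powr p * bump_mass p) = N powr (p - 1) * bump_mass p"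
    using N by (simp add: powr_diff)
  finally show ?thesis .
qed

lemma Lp_space_if_le_bump:
  assumes f: "f \<in> borel_measurable lebesgue" and p: "1 < p" and N: "0 < N" and c: "0 \<le> c"
    and le: "\<And>t. norm (f t) \<le> c * bump N x t"
  shows "f \<in> Lp_space p" "(\<integral>t. norm (f t) powr p \<partial>lebesgue) \<le> c powr p * (N powr (p - 1) * bump_mass p)"
proof -
  have "(\<integral>\<^sup>+t. ennreal (norm (f t) powr p) \<partial>lebesgue) \<le> (\<integral>\<^sup>+t. ennreal (c powr p) * ennreal (bump N x t powr p) \<partial>lebesgue)"
  proof (rule nn_integral_mono)
    fix t
    have "norm (f t) powr p \<le> (c * bump N x t) powr p" using p le by (intro powr_mono2) auto
    also have "\<dots> = c powr p * bump N x t powr p" using c bump_pos[OF N, of x t] by (simp add: powr_mult)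
    finally show "ennreal (norm (f t) powr p) \<le> ennreal (c powr p) * ennreal (bump N x t powr p)"
      by (simp flip: ennreal_mult)
  qed
  also have "\<dots> = ennreal (c powr p) * ennreal (N powr (p - 1) * bump_mass p)"
    using nn_integral_bump[OF p N, of x]
    by (subst nn_integral_cmult) (auto intro!: measurable_completion)
  also have "\<dots> = ennreal (c powr p * (N powr (p - 1) * bump_mass p))"
    by (simp add: ennreal_mult bump_mass_nonneg)
  finally have *: "(\<integral>\<^sup>+t. ennreal (norm (f t) powr p) \<partial>lebesgue) \<le> ennreal (c powr p * (N powr (p - 1) * bump_mass p))" .
  have "0 \<le> c powr p * (N powr (p - 1) * bump_mass p)" by (simp add: bump_mass_nonneg)
  then show "f \<in> Lp_space p" "(\<integral>t. norm (f t) powr p \<partial>lebesgue) \<le> c powr p * (N powr (p - 1) * bump_mass p)"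
    using Lp_space_bounded_by[OF f *] by auto
qed

text \<open>The sum of the absolute values of real and imaginary part is at most twice the
  modulus.\<close>

lemma norm_inverse_le_bump:
  assumes d: "0 < d" "d \<le> \<bar>Im w\<bar>" and x: "Re w = t - x"
  shows "norm (1 / w) \<le> 2 * bump (1 / d) x t"
proof -
  have "\<bar>t - x\<bar> \<le> norm w" "d \<le> norm w"
    using abs_Re_le_cmod[of w] abs_Im_le_cmod[of w] d x by auto
  then have "(d + \<bar>t - x\<bar>) / 2 \<le> norm w" by simp
  then have "1 / norm w \<le> 1 / ((d + \<bar>t - x\<bar>) / 2)"
    using d by (intro divide_left_mono) (auto intro!: mult_pos_pos add_pos_nonneg)
  also have "\<dots> = 2 * bump (1 / d) x t"
    using d by (simp add: bump_def field_simps)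
  finally show ?thesis by (simp add: norm_divide)
qed

section \<open>Cauchy integrals in a strip\<close>

lemma contour_integral_linepath_same_Im:
  assumes "u < v"
  shows "contour_integral (linepath (Complex u c) (Complex v c)) f = integral {u..v} (\<lambda>x. f (Complex x c))"
proof -
  \<comment> \<open>Exchanging the coordinates turns the horizontal segment into a vertical
    one.\<close>
  define g where "g w = f (Complex (Im w) (Re w))" for w
  have "contour_integral (linepath (Complex c u) (Complex c v)) g = \<i> * integral {u..v} (\<lambda>x. f (Complex x c))"
    using assms by (subst contour_integral_linepath_same_Re[of _ c _ u v]) (auto simp: g_def)
  moreover have "contour_integral (linepath (Complex c u) (Complex c v)) g =
      \<i> * contour_integral (linepath (Complex u c) (Complex v c)) f"
  proof -
    have "Complex c v - Complex c u = \<i> * (Complex v c - Complex u c)" by (simp add: complex_eq_iff)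
    moreover have "g (linepath (Complex c u) (Complex c v) x) = f (linepath (Complex u c) (Complex v c) x)" for x
      unfolding g_def by (rule arg_cong[of _ _ f]) (simp add: linepath_def complex_eq_iff algebra_simps)
    ultimately show ?thesis by (simp add: contour_integral_integral)
  qed
  ultimately show ?thesis by simp
qed

lemma contour_integral_rectpath:
  assumes g: "continuous_on (path_image (rectpath (Complex u a) (Complex v b))) g"
    and "u < v" "a < b"
  shows "contour_integral (rectpath (Complex u a) (Complex v b)) g =
     integral {u..v} (\<lambda>x. g (Complex x a)) - integral {u..v} (\<lambda>x. g (Complex x b))
     + \<i> * integral {a..b} (\<lambda>y. g (Complex v y)) - \<i> * integral {a..b} (\<lambda>y. g (Complex u y))"
proof -
  define A B C D where "A = Complex u a" and "B = Complex v a" and "C = Complex v b" and "D = Complex u b"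
  have r: "rectpath A C = linepath A B +++ linepath B C +++ linepath C D +++ linepath D A"
    by (simp add: rectpath_def Let_def A_def B_def C_def D_def)
  have "path_image (rectpath A C) = closed_segment A B \<union> closed_segment B C \<union> closed_segment C D \<union> closed_segment D A"
    unfolding r by (auto simp: path_image_join)
  then have c: "continuous_on (closed_segment A B) g" "continuous_on (closed_segment B C) g"
     "continuous_on (closed_segment C D) g" "continuous_on (closed_segment D A) g"
    using g by (auto simp: A_def C_def intro: continuous_on_subset)
  note i = c[THEN contour_integrable_continuous_linepath]
  have "contour_integral (rectpath A C) g = contour_integral (linepath A B) g + (contour_integral (linepath B C) g
    + (contour_integral (linepath C D) g + contour_integral (linepath D A) g))"
    unfolding r using i by (simp add: contour_integrable_join)
  also have "contour_integral (linepath C D) g = - contour_integral (linepath D C) g"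
    using contour_integral_reverse_linepath[OF c(3)] by simp
  also have "contour_integral (linepath D A) g = - contour_integral (linepath A D) g"
    using contour_integral_reverse_linepath[OF c(4)] by simp
  finally show ?thesis
    using assms unfolding A_def B_def C_def D_def
    by (simp add: contour_integral_linepath_same_Im contour_integral_linepath_same_Re)
qed

lemma integrable_symmetric_limit:
  fixes h :: "real \<Rightarrow> complex"
  assumes h: "integrable lebesgue h" and R: "filterlim R at_top sequentially"
  shows "(\<lambda>n. integral {- R n..R n} h) \<longlonglongrightarrow> (\<integral>x. h x \<partial>lebesgue)"
proof -
  have hm: "h \<in> borel_measurable lebesgue" using h by auto
  then have im: "(\<lambda>x. indicator {- R n..R n} x *\<^sub>R h x) \<in> borel_measurable lebesgue" for n
    by (intro borel_measurable_scaleR borel_measurable_indicator) auto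
  have eq: "integral {- R n..R n} h = (\<integral>x. indicator {- R n..R n} x *\<^sub>R h x \<partial>lebesgue)" for n
  proof -
    have "set_integrable lebesgue {- R n..R n} h"
      unfolding set_integrable_def by (rule Bochner_Integration.integrable_bound[OF h im]) (auto simp: indicator_def)
    from set_lebesgue_integral_eq_integral(2)[OF this] show ?thesis by (simp add: set_lebesgue_integral_def)
  qed
  show ?thesis unfolding eq
  proof (rule integral_dominated_convergence[where w = "\<lambda>x. norm (h x)"])
    show "AE x in lebesgue. (\<lambda>n. indicator {- R n..R n} x *\<^sub>R h x) \<longlonglongrightarrow> h x"
    proof (rule AE_I2)
      fix x :: real
      have "eventually (\<lambda>n. \<bar>x\<bar> \<le> R n) sequentially" using R by (simp add: filterlim_at_top)
      then have "eventually (\<lambda>n. indicator {- R n..R n} x *\<^sub>R h x = h x) sequentially"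
        by eventually_elim (auto simp: indicator_def)
      then show "(\<lambda>n. indicator {- R n..R n} x *\<^sub>R h x) \<longlonglongrightarrow> h x" by (rule tendsto_eventually)
    qed
    show "AE x in lebesgue. norm (indicator {- R n..R n} x *\<^sub>R h x) \<le> norm (h x)" for n
      by (rule AE_I2) (auto simp: indicator_def)
    show "integrable lebesgue (\<lambda>x. norm (h x))" using h by (rule integrable_norm)
  qed (use hm im in auto)
qed

lemma finite_nn_integral_small_values:
  fixes W :: "real \<Rightarrow> ennreal"
  assumes [measurable]: "W \<in> borel_measurable borel" and fin: "(\<integral>\<^sup>+x. W x \<partial>lborel) < \<infinity>"
  obtains R where "L \<le> R" "W R < 1" "W (- R) < 1"
proof (rule ccontr)
  \<comment> \<open>Otherwise \<open>W x + W (- x) \<ge> 1\<close> on a half-line.\<close>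
  assume "\<not> thesis"
  with that have big: "1 \<le> W R \<or> 1 \<le> W (- R)" if "L \<le> R" for R by (meson not_less \<open>L \<le> R\<close>)
  have "(\<integral>\<^sup>+x. indicator {L..} x \<partial>lborel) \<le> (\<integral>\<^sup>+x. W x + W (- x) \<partial>lborel)"
  proof (rule nn_integral_mono)
    fix x
    show "indicator {L..} x \<le> W x + W (- x)"
    proof (cases "L \<le> x")
      case True
      from big[OF this] have "1 \<le> W x + W (- x)" by (metis add_increasing add_increasing2 zero_le)
      then show ?thesis using True by simp
    qed simp
  qed
  also have "\<dots> = (\<integral>\<^sup>+x. W x \<partial>lborel) + (\<integral>\<^sup>+x. W (- x) \<partial>lborel)" by (rule nn_integral_add) auto
  also have "(\<integral>\<^sup>+x. W (- x) \<partial>lborel) = (\<integral>\<^sup>+x. W x \<partial>lborel)"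
    using nn_integral_real_affine[of W "-1" 0] by simp
  also have "\<dots> + \<dots> < \<infinity>" using fin by (simp add: less_top[symmetric] ennreal_add_eq_top)
  finally have "emeasure lborel {L..} < \<infinity>" by simp
  moreover have "emeasure lborel {L..} = \<infinity>"
  proof (rule ccontr)
    assume "emeasure lborel {L..} \<noteq> \<infinity>"
    then obtain r where r: "emeasure lborel {L..} = ennreal r" "0 \<le> r" by (cases "emeasure lborel {L..}") auto
    have "emeasure lborel {L..L + (r + 1)} \<le> emeasure lborel {L..}" by (rule emeasure_mono) auto
    then show False using r by (simp add: emeasure_lborel_Icc)
  qed
  ultimately show False by simp
qed

definition strip :: "real \<Rightarrow> real \<Rightarrow> complex set" where
  "strip \<alpha> \<beta> = {z. \<alpha> < Im z \<and> Im z < \<beta>}"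

lemma open_strip: "open (strip \<alpha> \<beta>)"
  unfolding strip_def by (intro open_Collect_conj open_halfspace_Im_gt open_halfspace_Im_lt)

lemma convex_strip: "convex (strip \<alpha> \<beta>)"
proof -
  have "strip \<alpha> \<beta> = {z. \<alpha> < Im z} \<inter> {z. Im z < \<beta>}" by (auto simp: strip_def)
  then show ?thesis by (simp add: convex_Int convex_halfspace_Im_gt convex_halfspace_Im_lt)
qed

lemma contour_integral_rectpath_Cauchy_kernel:
  assumes F: "F holomorphic_on strip \<alpha> \<beta>" and ab: "\<alpha> < a" "a < b" "b < \<beta>"
    and z: "Im z \<noteq> a" "Im z \<noteq> b" and R: "\<bar>Re z\<bar> < R"
  shows "contour_integral (rectpath (Complex (- R) a) (Complex R b)) (\<lambda>w. F w / (w - z)) =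
      (if a < Im z \<and> Im z < b then 2 * pi * \<i> * F z else 0)"
    "continuous_on (path_image (rectpath (Complex (- R) a) (Complex R b))) (\<lambda>w. F w / (w - z))"
proof -
  let ?r = "rectpath (Complex (- R) a) (Complex R b)"
  have img: "path_image ?r = cbox (Complex (- R) a) (Complex R b) - box (Complex (- R) a) (Complex R b)"
    using R ab by (intro path_image_rectpath_cbox_minus_box) auto
  have sub: "path_image ?r \<subseteq> strip \<alpha> \<beta> - {z}"
    unfolding img strip_def using ab R z by (auto simp: in_cbox_complex_iff in_box_complex_iff)
  show "continuous_on (path_image ?r) (\<lambda>w. F w / (w - z))"
    using sub holomorphic_on_imp_continuous_on[OF F]
    by (intro continuous_intros) (auto intro: continuous_on_subset)
  show "contour_integral ?r (\<lambda>w. F w / (w - z)) = (if a < Im z \<and> Im z < b then 2 * pi * \<i> * F z else 0)"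
  proof (cases "a < Im z \<and> Im z < b")
    case True
    have "((\<lambda>w. F w / (w - z)) has_contour_integral (2*pi * \<i> * winding_number ?r z * F z)) ?r"
    proof (rule Cauchy_integral_formula_convex_simple[OF convex_strip F])
      show "z \<in> interior (strip \<alpha> \<beta>)" using True ab by (simp add: interior_open[OF open_strip]) (simp add: strip_def)
    qed (use sub in auto)
    moreover have "winding_number ?r z = 1"
      using True R by (intro winding_number_rectpath) (auto simp: in_box_complex_iff)
    ultimately show ?thesis using True by (simp add: contour_integral_unique)
  next
    case False
    \<comment> \<open>A smaller strip that contains the rectangle but not
      \<open>z\<close>.\<close>
    define b' where "b' = (if Im z < a then max \<alpha> (Im z) else \<alpha>)"
    define c' where "c' = (if Im z < a then \<beta> else min \<beta> (Im z))"
    have s: "strip b' c' \<subseteq> strip \<alpha> \<beta>" "z \<notin> strip b' c'" "b' < a" "b < c'"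
      using False ab z by (auto simp: strip_def b'_def c'_def)
    have "((\<lambda>w. F w / (w - z)) has_contour_integral 0) ?r"
    proof (rule Cauchy_theorem_convex_simple[OF _ convex_strip])
      show "(\<lambda>w. F w / (w - z)) holomorphic_on strip b' c'"
        using s holomorphic_on_subset[OF F s(1)] by (intro holomorphic_intros) auto
      show "path_image ?r \<subseteq> strip b' c'"
        unfolding img using ab s by (auto simp: in_cbox_complex_iff strip_def)
    qed auto
    then show ?thesis using False by (auto simp: contour_integral_unique)
  qed
qed

lemma continuous_on_horizontal_line:
  assumes "continuous_on S F" "\<And>t. t \<in> T \<Longrightarrow> Complex t y \<in> S"
  shows "continuous_on T (\<lambda>t. F (Complex t y))"
  by (rule continuous_on_compose2[OF assms(1)]) (use assms(2) in \<open>auto simp: Complex_eq intro!: continuous_intros\<close>)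

lemma continuous_on_vertical_line:
  assumes "continuous_on S F" "\<And>t. t \<in> T \<Longrightarrow> Complex x t \<in> S"
  shows "continuous_on T (\<lambda>t. F (Complex x t))"
  by (rule continuous_on_compose2[OF assms(1)]) (use assms(2) in \<open>auto simp: Complex_eq intro!: continuous_intros\<close>)

text \<open>By Tonelli, \<open>|F|\<^sup>p\<close> is integrable over the strip between the
  heights \<open>a\<close> and \<open>b\<close>. Its integral over a vertical segment is therefore
  an integrable function of the abscissa, so it is at most \<open>1\<close> at arbitrarily distant
  pairs of opposite abscissas. This supplies the abscissas at which a rectangle is cut off without
  any pointwise bound on \<open>F\<close>.\<close>

lemma strip_vertical_integrals_small:
  assumes p: "0 < p" and F: "continuous_on (strip \<alpha> \<beta>) F" and ab: "\<alpha> < a" "a < b" "b < \<beta>"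
    and M: "\<And>y. a \<le> y \<Longrightarrow> y \<le> b \<Longrightarrow> (\<integral>\<^sup>+x. ennreal (norm (F (Complex x y)) powr p) \<partial>lebesgue) \<le> ennreal M"
  obtains R where "L \<le> R" "integral {a..b} (\<lambda>y. norm (F (Complex R y)) powr p) \<le> 1"
     "integral {a..b} (\<lambda>y. norm (F (Complex (- R) y)) powr p) \<le> 1"
     "\<And>x. (\<lambda>y. norm (F (Complex x y)) powr p) integrable_on {a..b}"
proof -
  define S where "S = {z. a \<le> Im z \<and> Im z \<le> b}"
  have Sc: "closed S" unfolding S_def by (intro closed_Collect_conj closed_halfspace_Im_ge closed_halfspace_Im_le)
  have Ss: "S \<subseteq> strip \<alpha> \<beta>" using ab by (auto simp: S_def strip_def)
  have "(\<lambda>z. indicator S z *\<^sub>R F z) \<in> borel_measurable borel"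
    using Sc continuous_on_subset[OF F Ss] by (intro borel_measurable_continuous_on_indicator) auto
  then have meas: "(\<lambda>(x, y). indicator S (Complex x y) *\<^sub>R F (Complex x y)) \<in> borel_measurable (borel \<Otimes>\<^sub>M borel)"
    unfolding split_beta by (rule measurable_compose[rotated]) (simp add: Complex_eq)
  \<comment> \<open>\<open>F\<close> is cut off outside the closed strip to be Borel measurable
    on the whole plane.\<close>
  define k where "k x y = ennreal (norm (indicator S (Complex x y) *\<^sub>R F (Complex x y)) powr p) * indicator {a..b} y" for x y
  have k: "k x y = ennreal (norm (F (Complex x y)) powr p) * indicator {a..b} y" for x y
    by (auto simp: k_def indicator_def S_def)
  have km [measurable]: "case_prod k \<in> borel_measurable (lborel \<Otimes>\<^sub>M lborel)"
    using meas unfolding k_def[abs_def] split_beta by measurable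
  define W where "W x = (\<integral>\<^sup>+y. k x y \<partial>lborel)" for x
  have Wm: "W \<in> borel_measurable borel"
    using lborel.borel_measurable_nn_integral[OF km] by (simp add: W_def[abs_def])
  have "(\<integral>\<^sup>+x. W x \<partial>lborel) = (\<integral>\<^sup>+y. (\<integral>\<^sup>+x. k x y \<partial>lborel) \<partial>lborel)"
    unfolding W_def by (rule lborel_pair.Fubini'[OF km, symmetric])
  also have "\<dots> \<le> (\<integral>\<^sup>+y. ennreal M * indicator {a..b} y \<partial>lborel)"
  proof (rule nn_integral_mono)
    fix y
    show "(\<integral>\<^sup>+x. k x y \<partial>lborel) \<le> ennreal M * indicator {a..b} y"
      using M[of y] by (auto simp: k indicator_def nn_integral_completion)
  qed
  also have "\<dots> < \<infinity>" using ab by (simp add: nn_integral_cmult_indicator ennreal_mult_less_top)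
  finally have fin: "(\<integral>\<^sup>+x. W x \<partial>lborel) < \<infinity>" .
  have int: "(\<lambda>y. norm (F (Complex x y)) powr p) integrable_on {a..b}"
     and W: "W x = ennreal (integral {a..b} (\<lambda>y. norm (F (Complex x y)) powr p))" for x
  proof -
    have "continuous_on {a..b} (\<lambda>y. norm (F (Complex x y)) powr p)"
      using p by (intro continuous_on_powr' continuous_intros continuous_on_vertical_line[OF F])
         (use ab in \<open>auto simp: strip_def\<close>)
    then show int: "(\<lambda>y. norm (F (Complex x y)) powr p) integrable_on {a..b}"
      by (rule integrable_continuous_real)
    show "W x = ennreal (integral {a..b} (\<lambda>y. norm (F (Complex x y)) powr p))"
      using nn_integral_has_integral_lebesgue'[OF _ integrable_integral[OF int]] by (simp add: W_def k)
  qed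
  obtain R where "L \<le> R" "W R < 1" "W (- R) < 1"
    using finite_nn_integral_small_values[OF Wm fin] by blast
  then show ?thesis using that[of R] int by (simp add: W less_imp_le)
qed

lemma strip_vertical_integral_bound:
  assumes p: "1 < p" and F: "continuous_on (strip \<alpha> \<beta>) F" and ab: "\<alpha> < a" "a < b" "b < \<beta>"
    and int: "(\<lambda>y. norm (F (Complex x y)) powr p) integrable_on {a..b}"
    and le: "integral {a..b} (\<lambda>y. norm (F (Complex x y)) powr p) \<le> 1"
    and x: "Re z \<noteq> x"
  shows "norm (integral {a..b} (\<lambda>y. F (Complex x y) / (Complex x y - z))) \<le> (b - a + 1) / \<bar>x - Re z\<bar>"
proof -
  have int1: "(\<lambda>y. (1 + norm (F (Complex x y)) powr p) / \<bar>x - Re z\<bar>) integrable_on {a..b}"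
    using int by (intro integrable_on_divide integrable_add) auto
  have "norm (integral {a..b} (\<lambda>y. F (Complex x y) / (Complex x y - z))) \<le>
     integral {a..b} (\<lambda>y. (1 + norm (F (Complex x y)) powr p) / \<bar>x - Re z\<bar>)"
  proof (rule integral_norm_bound_integral[OF _ int1])
    have "continuous_on {a..b} (\<lambda>y. F (Complex x y) / (Complex x y - z))"
      using x by (intro continuous_intros continuous_on_vertical_line[OF F])
         (use ab in \<open>auto simp: strip_def Complex_eq complex_eq_iff intro!: continuous_intros\<close>)
    then show "(\<lambda>y. F (Complex x y) / (Complex x y - z)) integrable_on {a..b}"
      by (rule integrable_continuous_real)
    fix y
    have 1: "\<bar>x - Re z\<bar> \<le> norm (Complex x y - z)" using abs_Re_le_cmod[of "Complex x y - z"] by simp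
    have 2: "norm (F (Complex x y)) \<le> 1 + norm (F (Complex x y)) powr p"
    proof (cases "norm (F (Complex x y)) \<le> 1")
      case False
      then have "norm (F (Complex x y)) powr 1 \<le> norm (F (Complex x y)) powr p"
        using p by (intro powr_mono) auto
      then show ?thesis using False by simp
    qed (smt (verit) powr_ge_zero)
    show "norm (F (Complex x y) / (Complex x y - z)) \<le> (1 + norm (F (Complex x y)) powr p) / \<bar>x - Re z\<bar>"
      unfolding norm_divide using 1 2 x by (intro frac_le) auto
  qed
  also have "integral {a..b} (\<lambda>y. (1 + norm (F (Complex x y)) powr p) / \<bar>x - Re z\<bar>) =
      integral {a..b} (\<lambda>y. 1 + norm (F (Complex x y)) powr p) / \<bar>x - Re z\<bar>" by simp
  also have "integral {a..b} (\<lambda>y. 1 + norm (F (Complex x y)) powr p) =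
      integral {a..b} (\<lambda>y. 1) + integral {a..b} (\<lambda>y. norm (F (Complex x y)) powr p)"
    using int by (intro integral_add) auto
  also have "\<dots> / \<bar>x - Re z\<bar> = (b - a + integral {a..b} (\<lambda>y. norm (F (Complex x y)) powr p)) / \<bar>x - Re z\<bar>"
    using ab by simp
  also have "\<dots> \<le> (b - a + 1) / \<bar>x - Re z\<bar>" using le by (intro divide_right_mono) auto
  finally show ?thesis .
qed

lemma Cauchy_kernel_Lp:
  assumes q: "1 < q" and z: "Im z \<noteq> 0"
  shows "(\<lambda>t. 1 / (of_real t - z)) \<in> Lp_space q"
    "(\<integral>t. norm (1 / (of_real t - z)) powr q \<partial>lebesgue) \<le> 2 powr q * ((1 / \<bar>Im z\<bar>) powr (q - 1) * bump_mass q)"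
proof -
  have le: "norm (1 / (of_real t - z)) \<le> 2 * bump (1 / \<bar>Im z\<bar>) (Re z) t" for t
    using z by (intro norm_inverse_le_bump) auto
  have m: "(\<lambda>t. 1 / (of_real t - z)) \<in> borel_measurable lebesgue"
    by (rule measurable_completion) simp
  show "(\<lambda>t. 1 / (of_real t - z)) \<in> Lp_space q"
    "(\<integral>t. norm (1 / (of_real t - z)) powr q \<partial>lebesgue) \<le> 2 powr q * ((1 / \<bar>Im z\<bar>) powr (q - 1) * bump_mass q)"
    using Lp_space_if_le_bump[OF m q _ _ le] z by auto
qed

lemma strip_line_Lp:
  assumes F: "continuous_on (strip \<alpha> \<beta>) F" and a: "\<alpha> < a" "a < \<beta>" and M0: "0 \<le> M"
    and M: "(\<integral>\<^sup>+x. ennreal (norm (F (Complex x a)) powr p) \<partial>lebesgue) \<le> ennreal M"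
  shows "(\<lambda>t. F (Complex t a)) \<in> Lp_space p" "(\<integral>x. norm (F (Complex x a)) powr p \<partial>lebesgue) \<le> M"
proof -
  have "continuous_on UNIV (\<lambda>t. F (Complex t a))"
    by (rule continuous_on_horizontal_line[OF F]) (use a in \<open>auto simp: strip_def\<close>)
  then have "(\<lambda>t. F (Complex t a)) \<in> borel_measurable lebesgue"
    by (intro measurable_completion) (simp add: borel_measurable_continuous_onI)
  then show "(\<lambda>t. F (Complex t a)) \<in> Lp_space p" "(\<integral>x. norm (F (Complex x a)) powr p \<partial>lebesgue) \<le> M"
    using Lp_space_bounded_by[OF _ M M0] by auto
qed

text \<open>Cauchy's theorem on the rectangles with vertical sides at \<open>\<plusminus>
  R\<^sub>n\<close>. The integrals over these sides are at most \<open>(b - a + 1) / |\<plusminus>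
  R\<^sub>n - Re z|\<close>, because \<open>|F| \<le> 1 + |F|\<^sup>p\<close>, and the horizontal
  sides converge to the full lines since \<open>F\<close> is in \<open>L\<^sup>p\<close> and the
  kernel in \<open>L\<^sup>q\<close>.\<close>

lemma Cauchy_integral_strip:
  assumes p: "1 < p" and F: "F holomorphic_on strip \<alpha> \<beta>" and ab: "\<alpha> < a" "a < b" "b < \<beta>"
    and M0: "0 \<le> M"
    and M: "\<And>y. \<alpha> < y \<Longrightarrow> y < \<beta> \<Longrightarrow> (\<integral>\<^sup>+x. ennreal (norm (F (Complex x y)) powr p) \<partial>lebesgue) \<le> ennreal M"
    and z: "Im z \<noteq> a" "Im z \<noteq> b"
  shows "(\<integral>t. F (Complex t a) * (1 / (Complex t a - z)) \<partial>lebesgue)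
       - (\<integral>t. F (Complex t b) * (1 / (Complex t b - z)) \<partial>lebesgue)
       = (if a < Im z \<and> Im z < b then 2 * pi * \<i> * F z else 0)"
proof -
  let ?g = "\<lambda>w. F w / (w - z)"
  define c where "c = (if a < Im z \<and> Im z < b then 2 * pi * \<i> * F z else 0)"
  have cont: "continuous_on (strip \<alpha> \<beta>) F" using F by (rule holomorphic_on_imp_continuous_on)
  have q: "1 < p / (p - 1)" using p by simp
  have line: "integrable lebesgue (\<lambda>t. ?g (Complex t y))" if y: "\<alpha> < y" "y < \<beta>" "Im z \<noteq> y" for y
  proof -
    have "(\<lambda>t. 1 / (Complex t y - z)) = (\<lambda>t. 1 / (of_real t - (z - \<i> * y)))"
      by (simp add: Complex_eq algebra_simps)
    then have "(\<lambda>t. 1 / (Complex t y - z)) \<in> Lp_space (p / (p - 1))"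
      using Cauchy_kernel_Lp(1)[OF q, of "z - \<i> * y"] y by simp
    from integrable_mult_Lp[OF p strip_line_Lp(1)[OF cont y(1,2) M0 M[OF y(1,2)]] this] show ?thesis by simp
  qed
  have "\<exists>R. max (\<bar>Re z\<bar> + 1) n \<le> R \<and> integral {a..b} (\<lambda>y. norm (F (Complex R y)) powr p) \<le> 1 \<and>
     integral {a..b} (\<lambda>y. norm (F (Complex (- R) y)) powr p) \<le> 1 \<and>
     (\<forall>x. (\<lambda>y. norm (F (Complex x y)) powr p) integrable_on {a..b})" for n :: nat
    by (rule strip_vertical_integrals_small[OF _ cont ab M, where L = "max (\<bar>Re z\<bar> + 1) n"]) (use p ab in auto)
  then obtain R where R: "\<And>n. max (\<bar>Re z\<bar> + 1) (real n) \<le> R n"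
     "\<And>n. integral {a..b} (\<lambda>y. norm (F (Complex (R n) y)) powr p) \<le> 1"
     "\<And>n. integral {a..b} (\<lambda>y. norm (F (Complex (- R n) y)) powr p) \<le> 1"
     and vint: "\<And>x. (\<lambda>y. norm (F (Complex x y)) powr p) integrable_on {a..b}"
    by metis
  have Rtop: "filterlim R at_top sequentially"
    by (rule filterlim_at_top_mono[OF filterlim_real_sequentially]) (use R(1) in auto)
  have v1: "(\<lambda>n. integral {a..b} (\<lambda>y. ?g (Complex (R n) y))) \<longlonglongrightarrow> 0"
  proof (rule Lim_null_comparison)
    have "Re z \<noteq> R n" for n using R(1)[of n] by (auto simp: max_def split: if_splits)
    then show "\<forall>\<^sub>F n in sequentially. norm (integral {a..b} (\<lambda>y. ?g (Complex (R n) y))) \<le> (b - a + 1) / \<bar>R n - Re z\<bar>"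
      using strip_vertical_integral_bound[OF p cont ab vint] R(2) by simp
    show "(\<lambda>n. (b - a + 1) / \<bar>R n - Re z\<bar>) \<longlonglongrightarrow> 0"
      by (intro tendsto_divide_0[OF tendsto_const] filterlim_at_top_imp_at_infinity filterlim_compose[OF filterlim_abs_real]
        filterlim_tendsto_add_at_top[of _ "- Re z", OF tendsto_const Rtop, simplified])
  qed
  have v2: "(\<lambda>n. integral {a..b} (\<lambda>y. ?g (Complex (- R n) y))) \<longlonglongrightarrow> 0"
  proof (rule Lim_null_comparison)
    have "Re z \<noteq> - R n" for n using R(1)[of n] by (auto simp: max_def split: if_splits)
    then show "\<forall>\<^sub>F n in sequentially. norm (integral {a..b} (\<lambda>y. ?g (Complex (- R n) y))) \<le> (b - a + 1) / \<bar>- R n - Re z\<bar>"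
      using strip_vertical_integral_bound[OF p cont ab vint] R(3) by simp
    have "\<bar>- R n - Re z\<bar> = \<bar>Re z + R n\<bar>" for n by simp
    then show "(\<lambda>n. (b - a + 1) / \<bar>- R n - Re z\<bar>) \<longlonglongrightarrow> 0"
      by (simp only:) (intro tendsto_divide_0[OF tendsto_const] filterlim_at_top_imp_at_infinity filterlim_compose[OF filterlim_abs_real]
        filterlim_tendsto_add_at_top[OF tendsto_const Rtop])
  qed
  have eq: "integral {- R n..R n} (\<lambda>x. ?g (Complex x a)) - integral {- R n..R n} (\<lambda>x. ?g (Complex x b))
     + \<i> * integral {a..b} (\<lambda>y. ?g (Complex (R n) y)) - \<i> * integral {a..b} (\<lambda>y. ?g (Complex (- R n) y)) = c" for n
  proof -
    have Rn: "\<bar>Re z\<bar> < R n" using R(1)[of n] by auto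
    show ?thesis
      using contour_integral_rectpath_Cauchy_kernel[OF F ab z Rn] ab Rn
        contour_integral_rectpath[of "- R n" a "R n" b ?g] by (simp add: c_def)
  qed
  have "(\<lambda>n. integral {- R n..R n} (\<lambda>x. ?g (Complex x a)) - integral {- R n..R n} (\<lambda>x. ?g (Complex x b))
     + \<i> * integral {a..b} (\<lambda>y. ?g (Complex (R n) y)) - \<i> * integral {a..b} (\<lambda>y. ?g (Complex (- R n) y)))
     \<longlonglongrightarrow> (\<integral>x. ?g (Complex x a) \<partial>lebesgue) - (\<integral>x. ?g (Complex x b) \<partial>lebesgue) + \<i> * 0 - \<i> * 0"
    by (intro tendsto_intros integrable_symmetric_limit line Rtop v1 v2) (use ab z in auto)
  from LIMSEQ_unique[OF this[unfolded eq] tendsto_const] show ?thesis by (simp add: c_def)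
qed

section \<open>Cauchy and Poisson formulas for Hardy functions\<close>

lemma bounded_SUP_ennrealE:
  fixes h :: "'a \<Rightarrow> ennreal"
  assumes "(SUP y\<in>A. h y) < \<infinity>"
  obtains M where "0 \<le> M" "\<And>y. y \<in> A \<Longrightarrow> h y \<le> ennreal M"
proof (cases "SUP y\<in>A. h y")
  case (real r)
  then show ?thesis using that[of r] by (metis SUP_upper)
next
  case top
  then show ?thesis using assms by (simp only: infinity_ennreal_def)
qed

lemma hardy_upperE:
  assumes "F \<in> hardy_upper p"
  obtains M where "0 \<le> M"
    "\<And>y. 0 < y \<Longrightarrow> (\<integral>\<^sup>+x. ennreal (norm (F (Complex x y)) powr p) \<partial>lebesgue) \<le> ennreal M"
    "F holomorphic_on upper_half_plane"
  using assms unfolding hardy_upper_def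
  by (auto elim!: bounded_SUP_ennrealE simp del: nn_integral_completion infinity_ennreal_def)

lemma open_upper_half_plane: "open upper_half_plane"
  by (simp add: upper_half_plane_def open_halfspace_Im_gt)

lemma upper_half_plane_strip: "strip 0 \<beta> \<subseteq> upper_half_plane"
  by (auto simp: strip_def upper_half_plane_def)

lemma tendsto_at_right_0_inverse_Suc:
  assumes "(f \<longlongrightarrow> l) (at_right (0::real))"
  shows "(\<lambda>n. f (inverse (real (Suc n)))) \<longlonglongrightarrow> l"
proof (rule filterlim_compose[OF assms])
  show "filterlim (\<lambda>n. inverse (real (Suc n))) (at_right 0) sequentially"
    unfolding filterlim_at using LIMSEQ_inverse_real_of_nat by simp
qed

lemma strip_lines_integral_tendsto:
  assumes p: "1 < p" and F: "continuous_on (strip \<alpha> \<beta>) F" and M0: "0 \<le> M"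
    and M: "\<And>y. \<alpha> < y \<Longrightarrow> y < \<beta> \<Longrightarrow> (\<integral>\<^sup>+x. ennreal (norm (F (Complex x y)) powr p) \<partial>lebesgue) \<le> ennreal M"
    and Y: "\<And>n. \<alpha> < Y n" "\<And>n. Y n < \<beta>"
    and lim: "AE x in lebesgue. (\<lambda>n. F (Complex x (Y n))) \<longlonglongrightarrow> f x"
    and f: "f \<in> Lp_space p" and z: "Im z \<noteq> 0"
  shows "(\<lambda>n. \<integral>t. F (Complex t (Y n)) * (1 / (of_real t - z)) \<partial>lebesgue)
     \<longlonglongrightarrow> (\<integral>t. f t * (1 / (of_real t - z)) \<partial>lebesgue)"
proof (rule Lp_bounded_AE_limit_weak[OF p _ f _ _ lim])
  show "(\<lambda>x. F (Complex x (Y n))) \<in> Lp_space p" "(\<integral>x. norm (F (Complex x (Y n))) powr p \<partial>lebesgue) \<le> M" for n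
    using strip_line_Lp[OF F Y(1)[of n] Y(2)[of n] M0 M[OF Y(1)[of n] Y(2)[of n]]] by auto
  show "(\<lambda>t. 1 / (of_real t - z)) \<in> Lp_space (p / (p - 1))"
    using p z by (intro Cauchy_kernel_Lp(1)) auto
qed

text \<open>Raising the line of integration from the boundary to height \<open>b\<close>, for a
  pole below the boundary. The boundary is approached by moving both lines and the pole up by a
  small \<open>a\<^sub>n\<close>: the kernel then stays fixed on each line, and only the factor
  \<open>G\<close> varies, converging weakly.\<close>

lemma Cauchy_integral_strip_boundary:
  assumes p: "1 < p" and G: "G holomorphic_on strip 0 \<beta>" and b: "0 < b" "b < \<beta>"
    and M0: "0 \<le> M"
    and M: "\<And>y. 0 < y \<Longrightarrow> y < \<beta> \<Longrightarrow> (\<integral>\<^sup>+x. ennreal (norm (G (Complex x y)) powr p) \<partial>lebesgue) \<le> ennreal M"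
    and g: "g \<in> Lp_space p" and bv: "upper_boundary_values G g" and z: "Im z < 0"
  shows "(\<integral>t. g t * (1 / (of_real t - z)) \<partial>lebesgue) = (\<integral>t. G (Complex t b) * (1 / (Complex t b - z)) \<partial>lebesgue)"
proof -
  have cont: "continuous_on (strip 0 \<beta>) G" using G by (rule holomorphic_on_imp_continuous_on)
  define a where "a n = (\<beta> - b) / 2 * inverse (real (Suc n))" for n
  have inv: "inverse (real (Suc n)) \<le> 1" for n by (simp add: field_simps)
  have a0: "0 < a n" for n using b by (simp add: a_def)
  have "a n < \<beta> - b" for n
  proof -
    have "a n \<le> (\<beta> - b) / 2 * 1" unfolding a_def using b inv[of n] by (intro mult_left_mono) auto
    also have "\<dots> < \<beta> - b" using b by simp
    finally show ?thesis .
  qed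
  then have a: "b + a n < \<beta>" "a n < \<beta>" for n using b by (smt (verit))+
  have alim: "a \<longlonglongrightarrow> 0" unfolding a_def using LIMSEQ_inverse_real_of_nat by (auto intro: tendsto_mult_right_zero)
  have l1: "(\<lambda>n. \<integral>t. G (Complex t (a n)) * (1 / (of_real t - z)) \<partial>lebesgue)
     \<longlonglongrightarrow> (\<integral>t. g t * (1 / (of_real t - z)) \<partial>lebesgue)"
  proof (rule strip_lines_integral_tendsto[OF p cont M0 M a0 a(2) _ g])
    have "filterlim a (at_right 0) sequentially"
      unfolding filterlim_at using alim a0 by (simp add: less_imp_neq[OF a0, symmetric])
    then show "AE x in lebesgue. (\<lambda>n. G (Complex x (a n))) \<longlonglongrightarrow> g x"
      using bv unfolding upper_boundary_values_def by (auto elim!: eventually_mono intro: filterlim_compose)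
  qed (use z in auto)
  have zb: "Im (z - \<i> * b) \<noteq> 0" using z b by simp
  have l2: "(\<lambda>n. \<integral>t. G (Complex t (b + a n)) * (1 / (of_real t - (z - \<i> * b))) \<partial>lebesgue)
     \<longlonglongrightarrow> (\<integral>t. G (Complex t b) * (1 / (of_real t - (z - \<i> * b))) \<partial>lebesgue)"
  proof (rule strip_lines_integral_tendsto[OF p cont M0 M _ a(1) _ strip_line_Lp(1)[OF cont b M0 M[OF b]] zb])
    show "0 < b + a n" for n using a0[of n] b by simp
    show "AE x in lebesgue. (\<lambda>n. G (Complex x (b + a n))) \<longlonglongrightarrow> G (Complex x b)"
    proof (rule AE_I2)
      fix x
      have "continuous (at (Complex x b)) G"
        using continuous_on_interior[OF cont] b by (simp add: interior_open[OF open_strip]) (simp add: strip_def)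
      moreover have "(\<lambda>n. Complex x (b + a n)) \<longlonglongrightarrow> Complex x (b + 0)"
        by (intro tendsto_Complex tendsto_add tendsto_const alim)
      then have "(\<lambda>n. Complex x (b + a n)) \<longlonglongrightarrow> Complex x b" by simp
      ultimately show "(\<lambda>n. G (Complex x (b + a n))) \<longlonglongrightarrow> G (Complex x b)"
        by (rule isCont_tendsto_compose)
    qed
  qed
  have "(\<integral>t. G (Complex t (a n)) * (1 / (of_real t - z)) \<partial>lebesgue)
     = (\<integral>t. G (Complex t (b + a n)) * (1 / (of_real t - (z - \<i> * b))) \<partial>lebesgue)" for n
  proof -
    have "Complex t (a n) - (z + \<i> * a n) = of_real t - z"
         "Complex t (b + a n) - (z + \<i> * a n) = of_real t - (z - \<i> * b)" for t
      by (simp_all add: complex_eq_iff)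
    then show ?thesis
      using Cauchy_integral_strip[OF p G a0[of n] _ a(1)[of n] M0 M, of "z + \<i> * a n"] z b
      by (simp only:) simp
  qed
  with LIMSEQ_unique[OF l1] l2 have "(\<integral>t. g t * (1 / (of_real t - z)) \<partial>lebesgue)
     = (\<integral>t. G (Complex t b) * (1 / (of_real t - (z - \<i> * b))) \<partial>lebesgue)" by simp
  moreover have "of_real t - (z - \<i> * b) = Complex t b - z" for t by (simp add: complex_eq_iff)
  ultimately show ?thesis by (simp only:)
qed

text \<open>The upper line of \<open>Cauchy_integral_strip\<close> is sent to infinity. The
  \<open>L\<^sup>p\<close> norms of \<open>F\<close> stay bounded, while the
  \<open>L\<^sup>q\<close> norm of the kernel at distance \<open>b - Im z\<close> decays like a
  negative power of this distance.\<close>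

lemma Cauchy_integral_hardy_line:
  assumes p: "1 < p" and F: "F \<in> hardy_upper p" and a: "0 < a" and z: "Im z \<noteq> a"
  shows "(\<integral>t. F (Complex t a) * (1 / (Complex t a - z)) \<partial>lebesgue) = (if a < Im z then 2 * pi * \<i> * F z else 0)"
proof -
  obtain M where M0: "0 \<le> M" and M:
    "\<And>y. 0 < y \<Longrightarrow> (\<integral>\<^sup>+x. ennreal (norm (F (Complex x y)) powr p) \<partial>lebesgue) \<le> ennreal M"
    and hol: "F holomorphic_on upper_half_plane" using hardy_upperE[OF F] by blast
  define q where "q = p / (p - 1)"
  have q: "1 < q" using p by (simp add: q_def)
  define c where "c = (if a < Im z then 2 * pi * \<i> * F z else 0)"
  define D where "D = (\<integral>t. F (Complex t a) * (1 / (Complex t a - z)) \<partial>lebesgue) - c"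
  have "norm D \<le> r" if r: "0 < r" for r
  proof -
    define \<epsilon> where "\<epsilon> = r / (2 * (M + 1))"
    have \<epsilon>: "0 < \<epsilon>" "\<epsilon> * M \<le> r / 2" using r M0 by (auto simp: \<epsilon>_def field_simps)
    obtain C where C: "0 < C"
      "\<And>a b. \<lbrakk>0 \<le> a; 0 \<le> b\<rbrakk> \<Longrightarrow> a * b \<le> \<epsilon> * a powr p + C * b powr (p / (p - 1))"
      using Young_scaled[OF p \<epsilon>(1)] by blast
    have "((\<lambda>b. C * (2 powr q * ((1 / (b - Im z)) powr (q - 1) * bump_mass q))) \<longlongrightarrow> C * (2 powr q * (0 * bump_mass q))) at_top"
    proof (intro tendsto_intros)
      have "((\<lambda>b. (b - Im z) powr (- (q - 1))) \<longlongrightarrow> 0) at_top"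
        using q filterlim_tendsto_add_at_top[OF tendsto_const[of "- Im z"] filterlim_ident[of at_top]]
        by (intro tendsto_neg_powr) (auto simp: algebra_simps)
      then show "((\<lambda>b. (1 / (b - Im z)) powr (q - 1)) \<longlongrightarrow> 0) at_top"
      proof (rule Lim_transform_eventually)
        show "eventually (\<lambda>b. (b - Im z) powr (- (q - 1)) = (1 / (b - Im z)) powr (q - 1)) at_top"
          using eventually_gt_at_top[of "Im z"]
          by eventually_elim (simp add: powr_divide powr_minus_divide powr_diff)
      qed
    qed
    then have "eventually (\<lambda>b. C * (2 powr q * ((1 / (b - Im z)) powr (q - 1) * bump_mass q)) < r / 2) at_top"
      using r by (auto dest: order_tendstoD(2)[of _ _ _ "r/2"])
    moreover have "eventually (\<lambda>b. max a (Im z) < b) at_top" by (rule eventually_gt_at_top)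
    ultimately have "eventually (\<lambda>b. C * (2 powr q * ((1 / (b - Im z)) powr (q - 1) * bump_mass q)) < r / 2 \<and> max a (Im z) < b) at_top"
      by (rule eventually_conj)
    then obtain b where b: "C * (2 powr q * ((1 / (b - Im z)) powr (q - 1) * bump_mass q)) < r / 2" "a < b" "Im z < b"
      unfolding eventually_at_top_linorder by auto
    have hol': "F holomorphic_on strip 0 (b + 1)" using hol upper_half_plane_strip by (rule holomorphic_on_subset)
    have "D = (\<integral>t. F (Complex t b) * (1 / (Complex t b - z)) \<partial>lebesgue)"
    proof -
      have "(\<integral>t. F (Complex t a) * (1 / (Complex t a - z)) \<partial>lebesgue) -
         (\<integral>t. F (Complex t b) * (1 / (Complex t b - z)) \<partial>lebesgue) = c"
        using Cauchy_integral_strip[OF p hol' a b(2) _ M0 M z] b(3) unfolding c_def by auto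
      then show ?thesis unfolding D_def by (simp only: diff_eq_eq add.commute)
    qed
    also have "Complex t b - z = of_real t - (z - \<i> * b)" for t by (simp add: complex_eq_iff)
    then have "(\<integral>t. F (Complex t b) * (1 / (Complex t b - z)) \<partial>lebesgue) = (\<integral>t. F (Complex t b) * (1 / (of_real t - (z - \<i> * b))) \<partial>lebesgue)"
      by (simp only:)
    also have "norm \<dots> \<le> \<epsilon> * (\<integral>t. norm (F (Complex t b)) powr p \<partial>lebesgue)
       + C * (\<integral>t. norm (1 / (of_real t - (z - \<i> * b))) powr (p / (p - 1)) \<partial>lebesgue)"
    proof (rule norm_integral_mult_Lp_le[OF p _ _ C(2)])
      show "(\<lambda>t. F (Complex t b)) \<in> Lp_space p"
        using a b holomorphic_on_imp_continuous_on[OF hol'] M0 M by (intro strip_line_Lp(1)[of 0 "b+1"]) auto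
      show "(\<lambda>t. 1 / (of_real t - (z - \<i> * b))) \<in> Lp_space (p / (p - 1))"
        using Cauchy_kernel_Lp(1)[OF q] b by (simp add: q_def)
    qed
    also have "\<dots> \<le> \<epsilon> * M + C * (2 powr q * ((1 / (b - Im z)) powr (q - 1) * bump_mass q))"
    proof (intro add_mono mult_left_mono)
      show "(\<integral>t. norm (F (Complex t b)) powr p \<partial>lebesgue) \<le> M"
        using a b holomorphic_on_imp_continuous_on[OF hol'] M0 M by (intro strip_line_Lp(2)[of 0 "b+1"]) auto
      have "\<bar>Im (z - \<i> * b)\<bar> = b - Im z" using b by simp
      then show "(\<integral>t. norm (1 / (of_real t - (z - \<i> * b))) powr (p / (p - 1)) \<partial>lebesgue) \<le> 2 powr q * ((1 / (b - Im z)) powr (q - 1) * bump_mass q)"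
        using Cauchy_kernel_Lp(2)[OF q, of "z - \<i> * b"] b by (simp add: q_def)
    qed (use C \<epsilon> in auto)
    also have "\<dots> \<le> r" using \<epsilon> b by simp
    finally show ?thesis .
  qed
  then have "norm D = 0" by (metis dense_ge norm_ge_zero order_antisym)
  then show ?thesis by (simp add: D_def c_def)
qed

theorem Cauchy_integral_hardy:
  assumes p: "1 < p" and F: "F \<in> hardy_upper p" and f: "f \<in> Lp_space p"
    and bv: "upper_boundary_values F f" and z: "Im z \<noteq> 0"
  shows "(\<integral>t. f t * (1 / (of_real t - z)) \<partial>lebesgue) = (if 0 < Im z then 2 * pi * \<i> * F z else 0)"
proof -
  obtain M where M0: "0 \<le> M" and M:
    "\<And>y. 0 < y \<Longrightarrow> (\<integral>\<^sup>+x. ennreal (norm (F (Complex x y)) powr p) \<partial>lebesgue) \<le> ennreal M"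
    and hol: "F holomorphic_on upper_half_plane" using hardy_upperE[OF F] by blast
  define a where "a n = inverse (real (Suc n))" for n
  have a: "0 < a n" "a n < 2" for n by (auto simp: a_def field_simps)
  have hol': "F holomorphic_on strip 0 2" using hol upper_half_plane_strip by (rule holomorphic_on_subset)
  have l: "(\<lambda>n. \<integral>t. F (Complex t (a n)) * (1 / (of_real t - z)) \<partial>lebesgue)
     \<longlonglongrightarrow> (\<integral>t. f t * (1 / (of_real t - z)) \<partial>lebesgue)"
  proof (rule strip_lines_integral_tendsto[OF p holomorphic_on_imp_continuous_on[OF hol'] M0 M a _ f z])
    show "AE x in lebesgue. (\<lambda>n. F (Complex x (a n))) \<longlonglongrightarrow> f x"
      using bv unfolding upper_boundary_values_def a_def
      by (rule eventually_mono) (rule tendsto_at_right_0_inverse_Suc)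
  qed
  have eq: "(\<integral>t. F (Complex t (a n)) * (1 / (of_real t - z)) \<partial>lebesgue) = (if 0 < Im z then 2 * pi * \<i> * F (z + \<i> * a n) else 0)" for n
  proof -
    have "Complex t (a n) - (z + \<i> * a n) = of_real t - z" for t by (simp add: complex_eq_iff)
    with Cauchy_integral_hardy_line[OF p F a(1)[of n], of "z + \<i> * a n"] z show ?thesis
      by (simp only:) simp
  qed
  have "(\<lambda>n. if 0 < Im z then 2 * pi * \<i> * F (z + \<i> * a n) else 0) \<longlonglongrightarrow> (if 0 < Im z then 2 * pi * \<i> * F z else 0)"
  proof (cases "0 < Im z")
    case True
    have "isCont F z"
      using True continuous_on_interior[OF holomorphic_on_imp_continuous_on[OF hol]]
      by (simp add: interior_open[OF open_upper_half_plane]) (simp add: upper_half_plane_def)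
    moreover have "(\<lambda>n. z + \<i> * a n) \<longlonglongrightarrow> z + \<i> * of_real 0"
      unfolding a_def by (intro tendsto_intros LIMSEQ_inverse_real_of_nat)
    then have "(\<lambda>n. z + \<i> * a n) \<longlonglongrightarrow> z" by simp
    ultimately have "(\<lambda>n. F (z + \<i> * a n)) \<longlonglongrightarrow> F z" by (rule isCont_tendsto_compose)
    then show ?thesis using True by (auto intro: tendsto_intros)
  qed auto
  with l show ?thesis unfolding eq by (rule LIMSEQ_unique)
qed

text \<open>Subtracting the Cauchy formula at \<open>cnj z\<close>, whose value is
  \<open>0\<close>, from that at \<open>z\<close> gives Poisson's formula. The Poisson kernel has
  a total mass that does not depend on \<open>z\<close>; the constant is not optimal, as the
  kernel is only compared with the square of \<open>bump (1 / Im z) (Re z)\<close>.\<close>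

lemma hardy_bounded_by_boundary_values:
  assumes p: "1 < p" and F: "F \<in> hardy_upper p" and f: "f \<in> Lp_space p"
    and bv: "upper_boundary_values F f" and B: "AE t in lebesgue. norm (f t) \<le> B" "0 \<le> B" and z: "0 < Im z"
  shows "norm (F z) \<le> 8 * bump_mass 2 / (2 * pi) * B"
proof -
  define y where "y = Im z"
  have y: "0 < y" using z by (simp add: y_def)
  have q: "1 < p / (p - 1)" using p by simp
  let ?k = "\<lambda>z t. 1 / (complex_of_real t - z)"
  have i: "integrable lebesgue (\<lambda>t. f t * ?k w t)" if "Im w \<noteq> 0" for w
    by (rule integrable_mult_Lp[OF p f Cauchy_kernel_Lp(1)[OF q that]])
  have kp: "?k z t - ?k (cnj z) t = 2 * \<i> * y / of_real ((t - Re z)^2 + y^2)" for t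
  proof -
    have nz: "of_real t - z \<noteq> 0" "of_real t - cnj z \<noteq> 0" using z by (auto simp: complex_eq_iff)
    have "(of_real t - z) * (of_real t - cnj z) = of_real ((t - Re z)^2 + y^2)"
      by (simp add: complex_eq_iff y_def power2_eq_square algebra_simps)
    moreover have "z - cnj z = 2 * \<i> * y" by (simp add: complex_eq_iff y_def)
    moreover have "?k z t - ?k (cnj z) t = (z - cnj z) / ((of_real t - z) * (of_real t - cnj z))"
      by (subst diff_frac_eq[OF nz]) simp
    ultimately show ?thesis by simp
  qed
  have bnd: "norm (?k z t - ?k (cnj z) t) \<le> 8 * y * (bump (1 / y) (Re z) t) powr 2" for t
  proof -
    have "norm (?k z t - ?k (cnj z) t) = 2 * y / ((t - Re z)^2 + y^2)"
      using y by (simp only: kp norm_divide norm_mult norm_of_real norm_ii) simp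
    also have "\<dots> \<le> 2 * y / ((y + \<bar>t - Re z\<bar>)^2 / 4)"
    proof (rule divide_left_mono)
      have le: "(y + \<bar>t - Re z\<bar>)^2 \<le> 2 * ((t - Re z)^2 + y^2)"
        using zero_le_power2[of "y - \<bar>t - Re z\<bar>"] by (simp add: power2_eq_square algebra_simps)
      have aux: "x / 4 \<le> w" if "x \<le> 2 * w" "0 \<le> w" for x w :: real using that by linarith
      show "(y + \<bar>t - Re z\<bar>)^2 / 4 \<le> (t - Re z)^2 + y^2" by (rule aux[OF le]) simp
    qed (use y in \<open>auto intro!: mult_pos_pos add_nonneg_pos\<close>)
    also have "\<dots> = 8 * y * (bump (1 / y) (Re z) t)^2"
      using y by (simp add: bump_def field_simps power2_eq_square)
    finally show ?thesis using bump_pos[of "1/y" "Re z" t] y by simp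
  qed
  have bi: "integrable lebesgue (\<lambda>t. bump (1 / y) (Re z) t powr 2)"
       "(\<integral>t. bump (1 / y) (Re z) t powr 2 \<partial>lebesgue) = bump_mass 2 / y"
  proof -
    have m: "(\<lambda>t. bump (1 / y) (Re z) t powr 2) \<in> borel_measurable lebesgue" by (rule measurable_completion) simp
    have n: "(\<integral>\<^sup>+t. ennreal (bump (1 / y) (Re z) t powr 2) \<partial>lebesgue) = ennreal (bump_mass 2 / y)"
      using nn_integral_bump[of 2 "1/y" "Re z"] y by simp
    show i: "integrable lebesgue (\<lambda>t. bump (1 / y) (Re z) t powr 2)"
      using m n by (simp add: integrable_iff_bounded)
    show "(\<integral>t. bump (1 / y) (Re z) t powr 2 \<partial>lebesgue) = bump_mass 2 / y"
      using integral_eq_nn_integral[OF m] n y by (simp add: bump_mass_nonneg)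
  qed
  have "2 * pi * \<i> * F z = (\<integral>t. f t * ?k z t \<partial>lebesgue) - (\<integral>t. f t * ?k (cnj z) t \<partial>lebesgue)"
    using Cauchy_integral_hardy[OF p F f bv, of z] Cauchy_integral_hardy[OF p F f bv, of "cnj z"] z by simp
  also have "\<dots> = (\<integral>t. f t * (?k z t - ?k (cnj z) t) \<partial>lebesgue)"
    using i[of z] i[of "cnj z"] z by (simp add: right_diff_distrib)
  finally have "norm (2 * pi * \<i> * F z) \<le> (\<integral>t. norm (f t * (?k z t - ?k (cnj z) t)) \<partial>lebesgue)" by simp
  also have "\<dots> \<le> (\<integral>t. B * (8 * y * bump (1 / y) (Re z) t powr 2) \<partial>lebesgue)"
  proof (rule integral_mono_AE)
    show "integrable lebesgue (\<lambda>t. norm (f t * (?k z t - ?k (cnj z) t)))"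
      using i[of z] i[of "cnj z"] z by (simp add: right_diff_distrib)
    show "AE t in lebesgue. norm (f t * (?k z t - ?k (cnj z) t)) \<le> B * (8 * y * bump (1 / y) (Re z) t powr 2)"
      using B(1)
    proof eventually_elim
      case (elim t)
      show ?case unfolding norm_mult by (rule mult_mono[OF elim bnd B(2) norm_ge_zero])
    qed
  qed (use bi in simp)
  also have "\<dots> = 8 * bump_mass 2 * B" using bi y by simp
  finally show ?thesis by (simp add: norm_mult field_simps)
qed

lemma AE_boundary_unimodular:
  assumes \<theta>: "inner_function \<theta>" and u: "upper_boundary_values \<theta> u"
  shows "AE x in lebesgue. norm (u x) = 1"
proof -
  obtain u0 where u0: "upper_boundary_values \<theta> u0" "AE x in lebesgue. norm (u0 x) = 1"
    using \<theta> by (auto simp: inner_function_def)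
  show ?thesis
    using u0 u unfolding upper_boundary_values_def
  proof eventually_elim
    case (elim x)
    then have "u x = u0 x" using tendsto_unique[of "at_right (0::real)"] by (metis trivial_limit_at_right_real)
    then show ?case using elim by simp
  qed
qed

section \<open>Boundedness of the model space\<close>

lemma hardy_lowerE:
  assumes "H \<in> hardy_lower p"
  obtains M where "0 \<le> M"
    "\<And>y. y < 0 \<Longrightarrow> (\<integral>\<^sup>+x. ennreal (norm (H (Complex x y)) powr p) \<partial>lebesgue) \<le> ennreal M"
    "H holomorphic_on lower_half_plane"
  using assms unfolding hardy_lower_def
  by (auto elim!: bounded_SUP_ennrealE simp del: nn_integral_completion infinity_ennreal_def)

text \<open>Near the boundary \<open>\<theta>\<close> can be inverted, so the factorisation
  \<open>f = u h\<close> continues \<open>F\<close> by reflection across the real line. Instead of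
  gluing, the reflected function \<open>G\<close>, whose boundary function is \<open>cnj
  f\<close>, is used to move the Cauchy integral for \<open>cnj (F z)\<close> away from the real
  line.\<close>

theorem model_space_subset_Hinf_plus_if_bounded:
  assumes p: "1 < p" and \<theta>: "inner_function \<theta>"
    and C: "\<And>w. 0 < Im w \<Longrightarrow> 1 - (norm (\<theta> w))\<^sup>2 \<le> C * Im w"
  shows "model_space p \<theta> \<subseteq> Hinf_plus"
proof
  fix f assume "f \<in> model_space p \<theta>"
  then obtain F u h H where f: "f \<in> Lp_space p" and F: "F \<in> hardy_upper p" and bvF: "upper_boundary_values F f"
    and u: "upper_boundary_values \<theta> u" and h: "h \<in> Lp_space p" and H: "H \<in> hardy_lower p"
    and bvH: "lower_boundary_values H h" and fuh: "AE x in lebesgue. f x = u x * h x"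
    unfolding model_space_def boundary_mult_def Hp_plus_def Hp_minus_def by blast
  have u1: "AE x in lebesgue. norm (u x) = 1" using AE_boundary_unimodular[OF \<theta> u] .
  have \<theta>hol: "\<theta> holomorphic_on upper_half_plane" using \<theta> by (simp add: inner_function_def hardy_inf_upper_def)
  obtain M where M0: "0 \<le> M" and M:
    "\<And>y. y < 0 \<Longrightarrow> (\<integral>\<^sup>+x. ennreal (norm (H (Complex x y)) powr p) \<partial>lebesgue) \<le> ennreal M"
    and Hhol: "H holomorphic_on lower_half_plane" using hardy_lowerE[OF H] by blast
  have Fhol: "F holomorphic_on upper_half_plane" using F by (simp add: hardy_upper_def)
  \<comment> \<open>The absolute value and the summand \<open>1\<close> serve to make
    \<open>\<beta>\<close> positive for every real \<open>C\<close>.\<close>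
  define \<beta> where "\<beta> = 1 / (2 * (\<bar>C\<bar> + 1))"
  have \<beta>: "0 < \<beta>" by (simp add: \<beta>_def)
  have \<theta>ge: "1 / 2 \<le> norm (\<theta> w)" if w: "0 < Im w" "Im w < \<beta>" for w
  proof -
    have "C * Im w \<le> (\<bar>C\<bar> + 1) * \<beta>" using w by (intro mult_mono) auto
    also have "\<dots> = 1 / 2" by (simp add: \<beta>_def)
    finally have "(1 / 2)\<^sup>2 \<le> (norm (\<theta> w))\<^sup>2" using C[OF w(1)] by (simp add: power2_eq_square)
    then show ?thesis by (rule power2_le_imp_le) auto
  qed
  define G where "G z = cnj (H (cnj z)) / \<theta> z" for z
  have Ghol: "G holomorphic_on strip 0 \<beta>"
  proof -
    have "cnj \<circ> H \<circ> cnj holomorphic_on upper_half_plane"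
      by (rule holomorphic_on_compose_cnj_cnj)
         (auto simp: upper_half_plane_def lower_half_plane_def open_halfspace_Im_gt intro: holomorphic_on_subset[OF Hhol])
    then have "(\<lambda>z. cnj (H (cnj z))) holomorphic_on strip 0 \<beta>"
      using upper_half_plane_strip by (auto simp: o_def intro: holomorphic_on_subset)
    moreover have "\<theta> holomorphic_on strip 0 \<beta>" using \<theta>hol upper_half_plane_strip by (rule holomorphic_on_subset)
    moreover have "\<theta> z \<noteq> 0" if "z \<in> strip 0 \<beta>" for z using \<theta>ge[of z] that by (auto simp: strip_def)
    ultimately show ?thesis unfolding G_def by (intro holomorphic_intros)
  qed
  have GM: "(\<integral>\<^sup>+x. ennreal (norm (G (Complex x y)) powr p) \<partial>lebesgue) \<le> ennreal (2 powr p * M)" if y: "0 < y" "y < \<beta>" for y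
  proof -
    have "(\<integral>\<^sup>+x. ennreal (norm (G (Complex x y)) powr p) \<partial>lebesgue) \<le>
      (\<integral>\<^sup>+x. ennreal (2 powr p) * ennreal (norm (H (Complex x (- y))) powr p) \<partial>lebesgue)"
    proof (rule nn_integral_mono)
      fix x
      have "norm (G (Complex x y)) = norm (H (Complex x (- y))) / norm (\<theta> (Complex x y))"
        by (simp add: G_def norm_divide complex_cnj)
      also have "\<dots> \<le> norm (H (Complex x (- y))) / (1 / 2)"
        using \<theta>ge[of "Complex x y"] y by (intro divide_left_mono) (auto intro!: mult_pos_pos)
      finally have "norm (G (Complex x y)) powr p \<le> (2 * norm (H (Complex x (- y)))) powr p"
        using p by (intro powr_mono2) auto
      then show "ennreal (norm (G (Complex x y)) powr p) \<le> ennreal (2 powr p) * ennreal (norm (H (Complex x (- y))) powr p)"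
        by (simp add: powr_mult flip: ennreal_mult)
    qed
    also have "\<dots> = ennreal (2 powr p) * (\<integral>\<^sup>+x. ennreal (norm (H (Complex x (- y))) powr p) \<partial>lebesgue)"
    proof (rule nn_integral_cmult)
      have "continuous_on UNIV (\<lambda>t. H (Complex t (- y)))"
        by (rule continuous_on_horizontal_line[OF holomorphic_on_imp_continuous_on[OF Hhol]])
           (use y in \<open>auto simp: lower_half_plane_def\<close>)
      then have [measurable]: "(\<lambda>t. H (Complex t (- y))) \<in> borel_measurable borel"
        by (simp add: borel_measurable_continuous_onI)
      show "(\<lambda>x. ennreal (norm (H (Complex x (- y))) powr p)) \<in> borel_measurable lebesgue"
        by (rule measurable_completion) simp
    qed
    also have "\<dots> \<le> ennreal (2 powr p) * ennreal M" using M[of "- y"] y by (intro mult_left_mono) auto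
    also have "\<dots> = ennreal (2 powr p * M)" using M0 by (simp add: ennreal_mult)
    finally show ?thesis .
  qed
  have bvG: "upper_boundary_values G (\<lambda>x. cnj (f x))"
    using u u1 bvH fuh unfolding upper_boundary_values_def lower_boundary_values_def
  proof eventually_elim
    case (elim x)
    have "filterlim uminus (at_left (0::real)) (at_right 0)"
      by (simp add: filterlim_at_left_to_right at_left_minus filterlim_def filtermap_filtermap)
    from filterlim_compose[OF elim(3) this]
    have "((\<lambda>y. cnj (H (Complex x (- y)))) \<longlongrightarrow> cnj (h x)) (at_right 0)" by (rule tendsto_cnj)
    then have "((\<lambda>y. cnj (H (Complex x (- y))) / \<theta> (Complex x y)) \<longlongrightarrow> cnj (h x) / u x) (at_right 0)"
      using elim by (intro tendsto_divide) auto
    \<comment> \<open>On the unit circle \<open>1 / u = cnj u\<close>.\<close>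
    moreover have "cnj (h x) / u x = cnj (f x)"
    proof -
      have "u x * cnj (u x) = 1" using elim(2) by (simp flip: complex_norm_square)
      moreover have "u x \<noteq> 0" using elim(2) by auto
      ultimately show ?thesis using elim(4) by (simp add: field_simps)
    qed
    ultimately show ?case by (simp add: G_def complex_cnj)
  qed
  have cf: "(\<lambda>x. cnj (f x)) \<in> Lp_space p"
    using f by (auto simp: Lp_space_def intro: borel_measurable_continuous_on[OF continuous_on_cnj[OF continuous_on_id]])
  define b where "b = \<beta> / 2"
  have b: "0 < b" "b < \<beta>" using \<beta> by (auto simp: b_def)
  define q where "q = p / (p - 1)"
  have q: "1 < q" using p by (simp add: q_def)
  have G0: "0 \<le> 2 powr p * M" using M0 by simp
  obtain D where D: "0 < D"
    "\<And>a b. \<lbrakk>0 \<le> a; 0 \<le> b\<rbrakk> \<Longrightarrow> a * b \<le> 1 * a powr p + D * b powr (p / (p - 1))"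
    using Young_scaled[OF p, of 1] by (metis zero_less_one)
  define K where "K = 2 powr p * M + D * (2 powr q * ((1 / b) powr (q - 1) * bump_mass q))"
  have K: "norm (F z) \<le> K / (2 * pi)" if z: "0 < Im z" for z
  proof -
    have "cnj (2 * pi * \<i> * F z) = cnj (\<integral>t. f t * (1 / (of_real t - z)) \<partial>lebesgue)"
      using Cauchy_integral_hardy[OF p F f bvF, of z] z by simp
    also have "\<dots> = (\<integral>t. cnj (f t * (1 / (of_real t - z))) \<partial>lebesgue)" by (rule Bochner_Integration.integral_cnj[symmetric])
    also have "\<dots> = (\<integral>t. cnj (f t) * (1 / (of_real t - cnj z)) \<partial>lebesgue)" by simp
    also have "\<dots> = (\<integral>t. G (Complex t b) * (1 / (Complex t b - cnj z)) \<partial>lebesgue)"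
      using z by (intro Cauchy_integral_strip_boundary[OF p Ghol b G0 GM cf bvG]) auto
    also have "Complex t b - cnj z = of_real t - (cnj z - \<i> * b)" for t by (simp add: complex_eq_iff)
    then have "(\<integral>t. G (Complex t b) * (1 / (Complex t b - cnj z)) \<partial>lebesgue) = (\<integral>t. G (Complex t b) * (1 / (of_real t - (cnj z - \<i> * b))) \<partial>lebesgue)"
      by (simp only:)
    finally have "norm (2 * pi * \<i> * F z) = norm (\<integral>t. G (Complex t b) * (1 / (of_real t - (cnj z - \<i> * b))) \<partial>lebesgue)"
      by (metis complex_mod_cnj)
    also have "\<dots> \<le> 1 * (\<integral>t. norm (G (Complex t b)) powr p \<partial>lebesgue)
       + D * (\<integral>t. norm (1 / (of_real t - (cnj z - \<i> * b))) powr (p / (p - 1)) \<partial>lebesgue)"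
    proof (rule norm_integral_mult_Lp_le[OF p _ _ D(2)])
      show "(\<lambda>t. G (Complex t b)) \<in> Lp_space p"
        by (rule strip_line_Lp(1)[OF holomorphic_on_imp_continuous_on[OF Ghol] b G0 GM[OF b]])
      show "(\<lambda>t. 1 / (of_real t - (cnj z - \<i> * b))) \<in> Lp_space (p / (p - 1))"
        using Cauchy_kernel_Lp(1)[OF q] b z by (simp add: q_def)
    qed
    also have "\<dots> \<le> 1 * (2 powr p * M) + D * (2 powr q * ((1 / b) powr (q - 1) * bump_mass q))"
    proof (intro add_mono mult_left_mono)
      show "(\<integral>t. norm (G (Complex t b)) powr p \<partial>lebesgue) \<le> 2 powr p * M"
        by (rule strip_line_Lp(2)[OF holomorphic_on_imp_continuous_on[OF Ghol] b G0 GM[OF b]])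
      have "(\<integral>t. norm (1 / (of_real t - (cnj z - \<i> * b))) powr (p / (p - 1)) \<partial>lebesgue) \<le>
         2 powr q * ((1 / \<bar>Im (cnj z - \<i> * b)\<bar>) powr (q - 1) * bump_mass q)"
        using Cauchy_kernel_Lp(2)[OF q, of "cnj z - \<i> * b"] b z by (simp add: q_def)
      also have "\<dots> \<le> 2 powr q * ((1 / b) powr (q - 1) * bump_mass q)"
        using b z q by (intro mult_left_mono mult_right_mono powr_mono2 divide_left_mono)
          (auto simp: bump_mass_nonneg intro!: mult_pos_pos)
      finally show "(\<integral>t. norm (1 / (of_real t - (cnj z - \<i> * b))) powr (p / (p - 1)) \<partial>lebesgue) \<le>
         2 powr q * ((1 / b) powr (q - 1) * bump_mass q)" .
    qed (use D in auto)
    finally have "2 * pi * norm (F z) \<le> K" by (simp add: norm_mult K_def)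
    then show ?thesis by (simp add: field_simps)
  qed
  have "F \<in> hardy_inf_upper"
    using K Fhol by (auto simp: hardy_inf_upper_def bounded_iff upper_half_plane_def)
  moreover have "AE x in lebesgue. norm (f x) \<le> K / (2 * pi)"
    using bvF unfolding upper_boundary_values_def
  proof eventually_elim
    case (elim x)
    show ?case
      by (rule tendsto_upperbound[OF tendsto_norm[OF elim]])
         (auto intro!: eventually_at_right_less[THEN eventually_mono] K)
  qed
  ultimately show "f \<in> Hinf_plus"
    using f bvF by (auto simp: Hinf_plus_def Linf_space_def Lp_space_def)
qed

section \<open>A gliding hump\<close>

text \<open>A quantitative form of the uniform boundedness principle. In the \<open>n\<close>-th
  step a function with very large supremum \<open>N\<^sub>n\<close> is chosen together with a
  point \<open>z\<^sub>n\<close> at which half of it is attained. Its contribution there is at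
  least \<open>N\<^sub>n powr (1 - r) / (2 * 4 ^ n)\<close>, which can be made to exceed the sum
  \<open>S\<close> of the suprema of all earlier terms. The later terms are harmless at
  \<open>z\<^sub>n\<close>, because all functions are bounded there by some \<open>T\<close> and
  the later weights contain factors with \<open>N powr (- r) * T \<le> 1\<close>.\<close>

lemma gliding_hump:
  fixes k :: "'w \<Rightarrow> 'z \<Rightarrow> complex" and r :: real
  assumes r: "0 < r" "r < 1"
    and bdd: "\<And>w. w \<in> W \<Longrightarrow> \<exists>B. \<forall>z\<in>Z. norm (k w z) \<le> B"
    and pt: "\<And>z. z \<in> Z \<Longrightarrow> \<exists>T. \<forall>w\<in>W. norm (k w z) \<le> T"
    and unb: "\<And>B. \<exists>w\<in>W. \<exists>z\<in>Z. B < norm (k w z)"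
  obtains w :: "nat \<Rightarrow> 'w" and N :: "nat \<Rightarrow> real"
    where "\<And>n. w n \<in> W" "\<And>n. 1 \<le> N n" "\<And>n z. z \<in> Z \<Longrightarrow> norm (k (w n) z) \<le> N n"
      "\<And>B. \<exists>z\<in>Z. B < norm (\<Sum>n. of_real ((1/4) ^ n * N n powr (- r)) * k (w n) z)"
proof -
  \<comment> \<open>A state consists of the function index \<open>w\<close>, its supremum
    \<open>N\<close>, the point \<open>z\<close>, a bound \<open>S\<close> (up to an additive
    constant) for the sum of the suprema so far, and a bound \<open>T\<close> for all functions at
    the points so far.\<close>
  define P where "P n s = (case s of (w, N, z, S, T) \<Rightarrow> w \<in> W \<and> z \<in> Z \<and> 1 \<le> N \<and>
      (\<forall>z'\<in>Z. norm (k w z') \<le> N) \<and> N / 2 \<le> norm (k w z) \<and> (\<forall>w'\<in>W. norm (k w' z) \<le> T))"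
    for n :: nat and s :: "'w \<times> real \<times> 'z \<times> real \<times> real"
  define Q where "Q n s s' = (case s of (w, N, z, S, T) \<Rightarrow> case s' of (w', N', z', S', T') \<Rightarrow>
      S' = S + (1/4) ^ Suc n * N' powr (1 - r) \<and> T \<le> T' \<and>
      S + n + 2 \<le> (1/4) ^ Suc n * N' powr (1 - r) / 2 \<and> N' powr (- r) * T \<le> 1)"
    for n :: nat and s s' :: "'w \<times> real \<times> 'z \<times> real \<times> real"
  have pick: "\<exists>w N z T. w \<in> W \<and> z \<in> Z \<and> 1 \<le> N \<and> B < N \<and> (\<forall>z'\<in>Z. norm (k w z') \<le> N) \<and>
      N / 2 \<le> norm (k w z) \<and> (\<forall>w'\<in>W. norm (k w' z) \<le> T) \<and> T0 \<le> T" for B T0 :: real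
  proof -
    obtain w z0 where w: "w \<in> W" "z0 \<in> Z" "max 1 B < norm (k w z0)" using unb[of "max 1 B"] by blast
    obtain B1 where B1: "\<forall>z\<in>Z. norm (k w z) \<le> B1" using bdd[OF w(1)] by blast
    define N where "N = (SUP z\<in>Z. norm (k w z))"
    have ba: "bdd_above ((\<lambda>z. norm (k w z)) ` Z)" using B1 by (auto simp: bdd_above_def)
    have le: "\<forall>z'\<in>Z. norm (k w z') \<le> N" unfolding N_def using ba by (auto intro: cSUP_upper)
    with w have N1: "max 1 B < N" by fastforce
    then have "N / 2 < N" by simp
    then obtain z where z: "z \<in> Z" "N / 2 < norm (k w z)"
      using ba w(2) unfolding N_def by (subst (asm) less_cSUP_iff) auto
    obtain T where T: "\<forall>w'\<in>W. norm (k w' z) \<le> T" using pt[OF z(1)] by blast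
    have "\<forall>w'\<in>W. norm (k w' z) \<le> max T T0" using T by fastforce
    then show ?thesis using w(1) z le N1 by (intro exI[of _ w] exI[of _ N] exI[of _ z] exI[of _ "max T T0"]) auto
  qed
  have "\<exists>f. \<forall>n. P n (f n) \<and> Q n (f n) (f (Suc n))"
  proof (rule dependent_nat_choice)
    obtain w N z T where "w \<in> W" "z \<in> Z" "1 \<le> N" "\<forall>z'\<in>Z. norm (k w z') \<le> N"
      "N / 2 \<le> norm (k w z)" "\<forall>w'\<in>W. norm (k w' z) \<le> T" using pick[of 0 0] by blast
    then have "P 0 (w, N, z, N powr (1 - r), T)" by (simp add: P_def)
    then show "\<exists>s. P 0 s" ..
  next
    fix s n assume "P n s"
    obtain w N z S T where s: "s = (w, N, z, S, T)" by (cases s) auto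
    define d X where "d = (1/4 :: real) ^ Suc n / 2" and "X = \<bar>S + n + 2\<bar> / d + 1"
    have d: "0 < d" by (simp add: d_def)
    then have X: "0 < X" "S + n + 2 \<le> d * X" by (auto simp: X_def add_nonneg_pos distrib_left)
    have e1: "eventually (\<lambda>N. S + n + 2 \<le> (1/4) ^ Suc n / 2 * N powr (1 - r)) at_top"
      using eventually_ge_at_top[of "X powr (1 / (1 - r))"]
    proof eventually_elim
      case (elim N)
      then have "(X powr (1 / (1 - r))) powr (1 - r) \<le> N powr (1 - r)" using r by (intro powr_mono2) auto
      then have "X \<le> N powr (1 - r)" using r X by (simp add: powr_powr)
      then have "d * X \<le> d * N powr (1 - r)" using d by (intro mult_left_mono) auto
      then have "S + n + 2 \<le> d * N powr (1 - r)" using X(2) by linarith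
      then show ?case unfolding d_def .
    qed
    have "((\<lambda>N. N powr (- r) * T) \<longlongrightarrow> 0 * T) at_top"
      using r by (intro tendsto_mult tendsto_const tendsto_neg_powr filterlim_ident) auto
    then have "eventually (\<lambda>N. N powr (- r) * T < 1) at_top" by (rule order_tendstoD(2)) auto
    with e1 have "eventually (\<lambda>N. S + n + 2 \<le> (1/4) ^ Suc n / 2 * N powr (1 - r) \<and> N powr (- r) * T < 1) at_top"
      by (rule eventually_conj)
    then obtain B where B: "\<And>N. B \<le> N \<Longrightarrow> S + n + 2 \<le> (1/4) ^ Suc n / 2 * N powr (1 - r) \<and> N powr (- r) * T < 1"
      unfolding eventually_at_top_linorder by blast
    obtain w' N' z' T' where "w' \<in> W" "z' \<in> Z" "1 \<le> N'" "B < N'" "\<forall>z''\<in>Z. norm (k w' z'') \<le> N'"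
      "N' / 2 \<le> norm (k w' z')" "\<forall>w''\<in>W. norm (k w'' z') \<le> T'" "T \<le> T'" using pick[of B T] by blast
    then have "P (Suc n) (w', N', z', S + (1/4) ^ Suc n * N' powr (1 - r), T') \<and>
       Q n s (w', N', z', S + (1/4) ^ Suc n * N' powr (1 - r), T')"
      using B[of N'] by (simp add: P_def Q_def s)
    then show "\<exists>s'. P (Suc n) s' \<and> Q n s s'" ..
  qed
  then obtain f where f: "\<And>n. P n (f n)" "\<And>n. Q n (f n) (f (Suc n))" by blast
  define w N z S T where "w n = fst (f n)" and "N n = fst (snd (f n))" and "z n = fst (snd (snd (f n)))"
    and "S n = fst (snd (snd (snd (f n))))" and "T n = snd (snd (snd (snd (f n))))" for n
  have fn: "f n = (w n, N n, z n, S n, T n)" for n by (simp add: w_def N_def z_def S_def T_def)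
  have P: "w n \<in> W" "z n \<in> Z" "1 \<le> N n" "\<And>z'. z' \<in> Z \<Longrightarrow> norm (k (w n) z') \<le> N n" "N n / 2 \<le> norm (k (w n) (z n))"
     "\<And>w'. w' \<in> W \<Longrightarrow> norm (k w' (z n)) \<le> T n" for n
    using f(1)[of n] by (auto simp: P_def fn)
  have Q: "S (Suc n) = S n + (1/4) ^ Suc n * N (Suc n) powr (1 - r)" "T n \<le> T (Suc n)"
      "S n + n + 2 \<le> (1/4) ^ Suc n * N (Suc n) powr (1 - r) / 2" "N (Suc n) powr (- r) * T n \<le> 1" for n
    using f(2)[of n] by (auto simp: Q_def fn)
  define c where "c n = (1/4) ^ n * N n powr (- r)" for n
  have c0: "0 \<le> c n" for n by (simp add: c_def)
  have cN: "c n * N n = (1/4) ^ n * N n powr (1 - r)" for n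
  proof -
    have "N n powr (1 - r) = N n powr (- r) * N n"
      using P(3)[of n] powr_add[of "N n" "- r" 1] by simp
    then show ?thesis by (simp add: c_def)
  qed
  have tel: "(\<Sum>i<Suc n. c i * N i) - c 0 * N 0 = S n - S 0" for n
    by (induction n) (auto simp: Q(1) cN)
  have S0: "\<exists>S'. \<forall>n. (\<Sum>i<Suc n. c i * N i) \<le> S n + S'"
    using tel by (intro exI[of _ "c 0 * N 0 - S 0"]) (smt (verit))
  then obtain S' where S': "\<And>n. (\<Sum>i<Suc n. c i * N i) \<le> S n + S'" by blast
  have T0: "0 \<le> T n" for n using P(6)[OF P(1), of n n] norm_ge_zero order_trans by blast
  have Tmono: "mono T" using Q(2) by (simp add: incseq_SucI)
  have tail: "norm (of_real (c (m + Suc n)) * k (w (m + Suc n)) (z n)) \<le> (1/4) ^ m" for m n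
  proof -
    have "norm (of_real (c (m + Suc n)) * k (w (m + Suc n)) (z n)) \<le> c (m + Suc n) * T n"
      using P(6)[OF P(1)[of "m + Suc n"], of n] c0 by (simp add: norm_mult mult_left_mono)
    also have "\<dots> \<le> c (Suc (m + n)) * T (m + n)" using monoD[OF Tmono, of n "m + n"] c0 by (simp add: mult_left_mono)
    also have "\<dots> = (1/4) ^ Suc (m + n) * (N (Suc (m + n)) powr (- r) * T (m + n))" by (simp add: c_def)
    also have "\<dots> \<le> (1/4) ^ Suc (m + n) * 1" using Q(4)[of "m + n"] by (intro mult_left_mono) auto
    also have "\<dots> \<le> (1/4) ^ m" using power_decreasing[of m "Suc (m + n)" "1/4 :: real"] by simp
    finally show ?thesis .
  qed
  have low: "real n - S' \<le> norm (\<Sum>i. of_real (c i) * k (w i) (z (Suc n)))" for n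
  proof -
    let ?a = "\<lambda>i. of_real (c i) * k (w i) (z (Suc n))"
    have geo: "summable (\<lambda>m. (1/4 :: real) ^ m)" by (rule summable_geometric) simp
    have st: "summable (\<lambda>m. norm (?a (m + Suc (Suc n))))"
      by (rule summable_comparison_test'[OF geo, of 0]) (use tail[of _ "Suc n"] in auto)
    then have sa: "summable ?a" by (subst summable_iff_shift[symmetric, of _ "Suc (Suc n)"]) (rule summable_norm_cancel)
    have "norm (\<Sum>m. ?a (m + Suc (Suc n))) \<le> (\<Sum>m. (1/4) ^ m)"
      by (rule order_trans[OF summable_norm[OF st] suminf_le[OF _ st geo]]) (rule tail)
    also have "\<dots> = 4 / 3" by (subst suminf_geometric) auto
    finally have t: "norm (\<Sum>m. ?a (m + Suc (Suc n))) \<le> 2" by simp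
    have "norm (\<Sum>i<Suc n. ?a i) \<le> (\<Sum>i<Suc n. c i * N i)"
      using P(4)[OF P(2)] c0 by (intro sum_norm_le) (simp add: norm_mult mult_left_mono)
    then have i: "norm (\<Sum>i<Suc n. ?a i) \<le> S n + S'" using S'[of n] by linarith
    have "S n + n + 2 \<le> c (Suc n) * (N (Suc n) / 2)" using Q(3)[of n] cN[of "Suc n"] by simp
    also have "\<dots> \<le> norm (?a (Suc n))" using mult_left_mono[OF P(5)[of "Suc n"] c0[of "Suc n"]] c0[of "Suc n"] by (simp add: norm_mult)
    finally have m: "S n + n + 2 \<le> norm (?a (Suc n))" .
    have "suminf ?a = (\<Sum>m. ?a (m + Suc (Suc n))) + ((\<Sum>i<Suc n. ?a i) + ?a (Suc n))"
      using suminf_split_initial_segment[OF sa, of "Suc (Suc n)"] by simp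
    then have "?a (Suc n) = suminf ?a - (\<Sum>m. ?a (m + Suc (Suc n))) - (\<Sum>i<Suc n. ?a i)" by simp
    then have "norm (?a (Suc n)) = norm (suminf ?a - (\<Sum>m. ?a (m + Suc (Suc n))) - (\<Sum>i<Suc n. ?a i))"
      by (rule arg_cong)
    also have "\<dots> \<le> norm (suminf ?a) + norm (\<Sum>m. ?a (m + Suc (Suc n))) + norm (\<Sum>i<Suc n. ?a i)"
      by (rule order_trans[OF norm_triangle_ineq4 add_right_mono[OF norm_triangle_ineq4]])
    finally show ?thesis using t i m by linarith
  qed
  show ?thesis
  proof (rule that[of w N])
    fix B
    obtain n where "B + S' < real n" using reals_Archimedean2 by blast
    then have "B < norm (\<Sum>i. of_real (c i) * k (w i) (z (Suc n)))" using low[of n] by linarith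
    then show "\<exists>z\<in>Z. B < norm (\<Sum>n. of_real ((1/4) ^ n * N n powr (- r)) * k (w n) z)"
      using P(2)[of "Suc n"] unfolding c_def by blast
  qed (use P in auto)
qed

section \<open>Inner functions in the upper half-plane\<close>

lemma holomorphic_line_measurable:
  assumes "F holomorphic_on upper_half_plane" "0 < y"
  shows "(\<lambda>t. F (Complex t y)) \<in> borel_measurable borel"
proof -
  have "continuous_on UNIV (\<lambda>t. F (Complex t y))"
    by (rule continuous_on_horizontal_line[OF holomorphic_on_imp_continuous_on[OF assms(1)]])
       (use assms in \<open>auto simp: upper_half_plane_def\<close>)
  then show ?thesis by (simp add: borel_measurable_continuous_onI)
qed

text \<open>The vertical limit along the heights \<open>1 / (n + 1)\<close> is Borel measurable,
  whatever the given representative.\<close>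

lemma borel_boundary_values:
  assumes F: "F holomorphic_on upper_half_plane" and f: "upper_boundary_values F f"
  obtains g where "g \<in> borel_measurable borel" "upper_boundary_values F g"
proof
  define g where "g x = lim (\<lambda>n. F (Complex x (inverse (real (Suc n)))))" for x
  show "g \<in> borel_measurable borel"
    unfolding g_def by (intro borel_measurable_lim_metric holomorphic_line_measurable[OF F]) auto
  show "upper_boundary_values F g"
    using f unfolding upper_boundary_values_def
  proof eventually_elim
    case (elim x)
    then have "(\<lambda>n. F (Complex x (inverse (real (Suc n))))) \<longlonglongrightarrow> f x"
      by (rule tendsto_at_right_0_inverse_Suc)
    then have "g x = f x" unfolding g_def by (rule limI)
    then show ?case using elim by simp
  qed
qed

lemma hardy_upper_dominated:
  fixes E :: "real \<Rightarrow> ennreal"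
  assumes F: "F holomorphic_on upper_half_plane" and E: "(\<integral>\<^sup>+t. E t \<partial>lebesgue) < \<infinity>"
    and le: "\<And>t s. 0 < s \<Longrightarrow> ennreal (norm (F (Complex t s)) powr p) \<le> E t"
  shows "F \<in> hardy_upper p"
proof -
  have "(SUP y\<in>{0<..}. \<integral>\<^sup>+ x. ennreal (norm (F (Complex x y)) powr p) \<partial>lebesgue) \<le> (\<integral>\<^sup>+t. E t \<partial>lebesgue)"
    by (intro SUP_least nn_integral_mono le) auto
  then show ?thesis using F E unfolding hardy_upper_def by (auto intro: le_less_trans)
qed

lemma Lp_space_dominated:
  fixes E :: "real \<Rightarrow> ennreal"
  assumes f: "f \<in> borel_measurable borel" and E: "(\<integral>\<^sup>+t. E t \<partial>lebesgue) < \<infinity>"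
    and le: "AE t in lebesgue. ennreal (norm (f t) powr p) \<le> E t"
  shows "f \<in> Lp_space p"
proof -
  have "(\<integral>\<^sup>+t. ennreal (norm (f t) powr p) \<partial>lebesgue) \<le> (\<integral>\<^sup>+t. E t \<partial>lebesgue)"
    by (rule nn_integral_mono_AE[OF le])
  then show ?thesis using f E by (auto simp: Lp_space_def intro: le_less_trans measurable_completion)
qed

lemma tendsto_vertical: "((\<lambda>y. Complex t y) \<longlongrightarrow> of_real t) (at_right 0)"
proof -
  have "((\<lambda>y. Complex t y) \<longlongrightarrow> Complex t 0) (at_right 0)" by (intro tendsto_intros)
  then show ?thesis by (simp add: complex_of_real_def)
qed

text \<open>Poisson's formula with an unspecified constant suffices: applied to \<open>\<theta>
  ^ n\<close> it bounds all powers of \<open>|\<theta> w|\<close> by one constant. The division by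
  \<open>\<zeta> - cnj w\<close> makes \<open>\<theta> ^ n\<close> square integrable on lines, and
  its boundary values have modulus at most \<open>1 / Im w\<close>, of the same order as the
  factor at \<open>\<zeta> = w\<close>.\<close>

lemma inner_function_norm_le_1:
  assumes \<theta>: "inner_function \<theta>" and w: "0 < Im w"
  shows "norm (\<theta> w) \<le> 1"
proof -
  have hol: "\<theta> holomorphic_on upper_half_plane" using \<theta> by (simp add: inner_function_def hardy_inf_upper_def)
  obtain u where u: "u \<in> borel_measurable borel" "upper_boundary_values \<theta> u"
    using \<theta> borel_boundary_values[OF hol] unfolding inner_function_def by blast
  note u1 = AE_boundary_unimodular[OF \<theta> u(2)]
  obtain B where B: "\<And>z. 0 < Im z \<Longrightarrow> norm (\<theta> z) \<le> B"
    using \<theta> by (auto simp: inner_function_def hardy_inf_upper_def bounded_iff upper_half_plane_def)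
  have B0: "0 \<le> B" using B[OF w] norm_ge_zero order_trans by blast
  define K where "K = 8 * bump_mass 2 / (2 * pi)"
  have pw: "norm (\<theta> w) ^ n \<le> 2 * K" for n
  proof -
    define G where "G z = \<theta> z ^ n * (1 / (z - cnj w))" for z
    define g where "g t = u t ^ n * (1 / (of_real t - cnj w))" for t
    have im: "Im w \<le> \<bar>Im (Complex t s - cnj w)\<bar>" if "0 \<le> s" for t s using that w by simp
    have ker: "norm (1 / (Complex t s - cnj w)) \<le> 2 * bump (1 / Im w) (Re w) t" if "0 \<le> s" for t s
      by (rule norm_inverse_le_bump[OF w im[OF that]]) simp
    have le: "norm a powr 2 \<le> (2 * B') powr 2 * bump (1 / Im w) (Re w) t powr 2"
      if "norm a \<le> B' * (2 * bump (1 / Im w) (Re w) t)" "0 \<le> B'" for a :: complex and B' t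
    proof -
      have "norm a powr 2 \<le> (2 * B' * bump (1 / Im w) (Re w) t) powr 2"
        using that by (intro powr_mono2) (auto simp: mult_ac)
      then show ?thesis using that bump_pos[of "1 / Im w"] w by (simp add: powr_mult)
    qed
    have E: "(\<integral>\<^sup>+t. ennreal ((2 * B') powr 2 * bump (1 / Im w) (Re w) t powr 2) \<partial>lebesgue) < \<infinity>" for B'
    proof -
      have "(\<lambda>t. ennreal (bump (1 / Im w) (Re w) t powr 2)) \<in> borel_measurable lebesgue"
        by (rule measurable_completion) simp
      then show ?thesis
        using nn_integral_bump[of 2 "1 / Im w" "Re w"] w
        by (simp add: ennreal_mult nn_integral_cmult ennreal_mult_less_top)
    qed
    have nz: "z - cnj w \<noteq> 0" if "0 \<le> Im z" for z using that w by (auto simp: complex_eq_iff)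
    have Ghol: "G holomorphic_on upper_half_plane"
      unfolding G_def using hol nz by (intro holomorphic_intros) (auto simp: upper_half_plane_def)
    have GH: "G \<in> hardy_upper 2"
    proof (rule hardy_upper_dominated[OF Ghol E[of "B ^ n"]])
      fix t s :: real assume s: "0 < s"
      have "norm (G (Complex t s)) \<le> B ^ n * (2 * bump (1 / Im w) (Re w) t)"
        unfolding G_def norm_mult norm_power using s B0 B[of "Complex t s"]
        by (intro mult_mono power_mono ker) auto
      from le[OF this] B0 show "ennreal (norm (G (Complex t s)) powr 2) \<le> ennreal ((2 * B ^ n) powr 2 * bump (1 / Im w) (Re w) t powr 2)"
        by (simp add: ennreal_leI)
    qed
    have bv: "upper_boundary_values G g"
      using u(2) unfolding upper_boundary_values_def
    proof eventually_elim
      case (elim t)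
      have "((\<lambda>y. Complex t y - cnj w) \<longlongrightarrow> of_real t - cnj w) (at_right 0)"
        by (intro tendsto_intros tendsto_vertical)
      then show ?case unfolding G_def g_def
        using elim nz[of "of_real t"] by (intro tendsto_mult tendsto_power tendsto_divide tendsto_const) auto
    qed
    have gLp: "g \<in> Lp_space 2"
    proof (rule Lp_space_dominated[OF _ E[of 1]])
      show "g \<in> borel_measurable borel" unfolding g_def using u(1) by measurable
      show "AE t in lebesgue. ennreal (norm (g t) powr 2) \<le> ennreal ((2 * 1) powr 2 * bump (1 / Im w) (Re w) t powr 2)"
        using u1
      proof eventually_elim
        case (elim t)
        have "norm (g t) \<le> 1 * (2 * bump (1 / Im w) (Re w) t)"
          using ker[of 0 t] elim by (simp add: g_def norm_mult norm_power norm_divide complex_of_real_def)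
        from le[OF this] show ?case by (simp add: ennreal_leI)
      qed
    qed
    have "norm (G w) \<le> K * (1 / Im w)"
      unfolding K_def
    proof (rule hardy_bounded_by_boundary_values[OF _ GH gLp bv])
      show "AE t in lebesgue. norm (g t) \<le> 1 / Im w"
        using u1
      proof eventually_elim
        case (elim t)
        have "Im w \<le> norm (of_real t - cnj w)" using abs_Im_le_cmod[of "of_real t - cnj w"] w by simp
        then show ?case using elim w by (simp add: g_def norm_mult norm_power norm_divide divide_left_mono frac_le)
      qed
    qed (use w in auto)
    moreover have "norm (w - cnj w) = 2 * Im w" using w by (simp add: complex_diff_cnj norm_mult)
    ultimately have "norm (\<theta> w) ^ n / (2 * Im w) \<le> K / Im w" by (simp add: G_def norm_mult norm_power norm_divide)
    then show ?thesis using w by (simp add: field_simps)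
  qed
  show ?thesis
  proof (rule ccontr)
    assume "\<not> norm (\<theta> w) \<le> 1"
    then obtain n where "2 * K < norm (\<theta> w) ^ n" using real_arch_pow[of "norm (\<theta> w)"] by auto
    then show False using pw[of n] by simp
  qed
qed

text \<open>The Schwarz lemma on the disc, transported by a Moebius transformation that takes
  \<open>0\<close> to \<open>w\<close>. It needs a map into the open disc, hence the detour
  through \<open>r f\<close> with \<open>r < 1\<close>.\<close>

lemma Schwarz_Pick_upper_half_plane:
  assumes f: "f holomorphic_on upper_half_plane" and le: "\<And>z. 0 < Im z \<Longrightarrow> norm (f z) \<le> 1"
    and w: "0 < Im w" and z: "0 < Im z"
  shows "norm (f z - f w) * norm (z - cnj w) \<le> norm (1 - cnj (f w) * f z) * norm (z - w)"
proof -
  have strict: "norm (of_real r * f z - of_real r * f w) * norm (z - cnj w) \<le>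
      norm (1 - cnj (of_real r * f w) * (of_real r * f z)) * norm (z - w)" if r: "0 < r" "r < 1" for r :: real
  proof -
    define g where "g z = of_real r * f z" for z
    have gn: "norm (g z) < 1" if "0 < Im z" for z
    proof -
      have "r * norm (f z) \<le> r * 1" using le[OF that] r by (intro mult_left_mono) auto
      then have "r * norm (f z) < 1" using r by linarith
      then show ?thesis using r by (simp add: g_def norm_mult)
    qed
    \<comment> \<open>The inverse of \<open>z \<mapsto> (z - w) / (z - cnj w)\<close>.\<close>
    define C where "C \<zeta> = (w - cnj w * \<zeta>) / (1 - \<zeta>)" for \<zeta>
    have nz1: "1 - \<zeta> \<noteq> 0" if "norm \<zeta> < 1" for \<zeta> :: complex using that by auto
    have CIm: "0 < Im (C \<zeta>)" if "norm \<zeta> < 1" for \<zeta>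
    proof -
      have "Im (C \<zeta>) = Im ((w - cnj w * \<zeta>) * cnj (1 - \<zeta>)) / (norm (1 - \<zeta>))\<^sup>2"
        unfolding C_def by (subst complex_div_cnj) simp
      also have "Im ((w - cnj w * \<zeta>) * cnj (1 - \<zeta>)) = Im w * (1 - (norm \<zeta>)\<^sup>2)"
        unfolding cmod_power2 by (simp add: algebra_simps power2_eq_square)
      finally show ?thesis using w that nz1[OF that] by (simp add: power_less_one_iff abs_square_less_1)
    qed
    have C0: "C 0 = w" by (simp add: C_def)
    define \<phi> where "\<phi> \<zeta> = Moebius_function 0 (g w) (g (C \<zeta>))" for \<zeta>
    define \<zeta> where "\<zeta> = (z - w) / (z - cnj w)"
    have nz: "z - cnj w \<noteq> 0" using w z by (auto simp: complex_eq_iff)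
    have "(norm (z - w))\<^sup>2 < (norm (z - cnj w))\<^sup>2"
      using mult_pos_pos[OF w z] unfolding cmod_power2 by (simp add: power2_eq_square algebra_simps)
    then have "norm (z - w) < norm (z - cnj w)" by (rule power2_less_imp_less) auto
    then have \<zeta>1: "norm \<zeta> < 1" using nz by (simp add: \<zeta>_def norm_divide)
    have C\<zeta>: "C \<zeta> = z"
    proof -
      have "1 - \<zeta> = (w - cnj w) / (z - cnj w)" using nz by (simp add: \<zeta>_def field_simps)
      moreover have "w - cnj w * \<zeta> = z * (w - cnj w) / (z - cnj w)" using nz by (simp add: \<zeta>_def field_simps)
      moreover have "w - cnj w \<noteq> 0" using w by (auto simp: complex_eq_iff)
      ultimately show ?thesis using nz by (simp add: C_def)
    qed
    have "norm (\<phi> \<zeta>) \<le> norm \<zeta>"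
    proof (rule Schwarz_Lemma(1)[OF _ _ _ \<zeta>1])
      have "C holomorphic_on ball 0 1" unfolding C_def using nz1 by (intro holomorphic_intros) auto
      moreover have "g holomorphic_on C ` ball 0 1"
        unfolding g_def using CIm by (intro holomorphic_intros holomorphic_on_subset[OF f]) (auto simp: upper_half_plane_def)
      ultimately have "(\<lambda>\<zeta>. g (C \<zeta>)) holomorphic_on ball 0 1"
        using holomorphic_on_compose[of C "ball 0 1" g] by (simp add: o_def)
      moreover have "Moebius_function 0 (g w) holomorphic_on (\<lambda>\<zeta>. g (C \<zeta>)) ` ball 0 1"
        using gn CIm by (intro holomorphic_on_subset[OF Moebius_function_holomorphic[OF gn[OF w]]]) auto
      ultimately show "\<phi> holomorphic_on ball 0 1"
        using holomorphic_on_compose[of "\<lambda>\<zeta>. g (C \<zeta>)" "ball 0 1" "Moebius_function 0 (g w)"] by (simp add: o_def \<phi>_def[abs_def])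
      show "\<phi> 0 = 0" by (simp add: \<phi>_def C0 Moebius_function_eq_zero)
      show "norm (\<phi> \<xi>) < 1" if "norm \<xi> < 1" for \<xi>
        unfolding \<phi>_def by (rule Moebius_function_norm_lt_1) (use gn w CIm[OF that] in auto)
    qed
    then have "norm (g z - g w) / norm (1 - cnj (g w) * g z) \<le> norm (z - w) / norm (z - cnj w)"
      unfolding \<phi>_def C\<zeta> Moebius_function_simple by (simp add: \<zeta>_def norm_divide)
    moreover have "1 - cnj (g w) * g z \<noteq> 0"
    proof
      assume "1 - cnj (g w) * g z = 0"
      then have "norm (g w) * norm (g z) = 1" by (metis complex_mod_cnj eq_iff_diff_eq_0 norm_mult norm_one)
      moreover have "norm (g w) * norm (g z) < 1 * 1" using gn[OF w] gn[OF z] by (intro mult_strict_mono) auto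
      ultimately show False by simp
    qed
    ultimately show ?thesis using nz unfolding g_def by (simp add: divide_le_eq field_simps)
  qed
  have L: "((\<lambda>r. norm (of_real r * f z - of_real r * f w) * norm (z - cnj w)) \<longlongrightarrow> norm (of_real 1 * f z - of_real 1 * f w) * norm (z - cnj w)) (at_left 1)"
    by (intro tendsto_intros)
  have R: "((\<lambda>r. norm (1 - cnj (of_real r * f w) * (of_real r * f z)) * norm (z - w)) \<longlongrightarrow> norm (1 - cnj (of_real 1 * f w) * (of_real 1 * f z)) * norm (z - w)) (at_left 1)"
    by (intro tendsto_intros)
  have "norm (of_real 1 * f z - of_real 1 * f w) * norm (z - cnj w) \<le> norm (1 - cnj (of_real 1 * f w) * (of_real 1 * f z)) * norm (z - w)"
  proof (rule tendsto_le[OF _ R L])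
    have "eventually (\<lambda>r. r \<in> {0<..<1}) (at_left (1::real))" by (rule eventually_at_left_real) simp
    then show "eventually (\<lambda>r. norm (of_real r * f z - of_real r * f w) * norm (z - cnj w) \<le>
      norm (1 - cnj (of_real r * f w) * (of_real r * f z)) * norm (z - w)) (at_left (1::real))"
      by eventually_elim (rule strict, auto)
  qed simp
  then show ?thesis by simp
qed

section \<open>Series in Hardy spaces\<close>

text \<open>The majorants \<open>b\<^sub>n\<close> of the terms do not depend on the height, so
  one function controls all horizontal lines. As \<open>\<Sum> 1 / 2 ^ (n + 1) = 1\<close>, the
  sum of the \<open>b\<^sub>n\<close> is at most the supremum of \<open>2 ^ (n + 1) *
  b\<^sub>n\<close>, and its \<open>p\<close>-th power at most \<open>E = \<Sum> (2 ^ (n + 1) *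
  b\<^sub>n)\<^sup>p\<close>. The factor \<open>N powr (- (p - 1) / p)\<close> in the weights
  cancels the growth of the \<open>L\<^sup>p\<close> norms of the bumps, and \<open>E\<close> is
  integrable. Wherever \<open>E\<close> is finite, the terms also have a summable majorant, and
  Tannery's theorem passes to the vertical limit without any maximal function.\<close>

lemma hardy_upper_series:
  assumes p: "1 < p" and N: "\<And>n. 1 \<le> N n"
    and G: "\<And>n. G n holomorphic_on upper_half_plane"
    and bump: "\<And>n z. 0 < Im z \<Longrightarrow> norm (G n z) \<le> 3 * bump (N n) (x n) (Re z)"
    and im: "\<And>n z. 0 < Im z \<Longrightarrow> norm (G n z) \<le> 2 / Im z"
    and bv: "\<And>n. upper_boundary_values (G n) (g n)"
    and g: "\<And>n. g n \<in> borel_measurable borel"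
    and c: "\<And>n. c n = (1/4) ^ n * N n powr (- ((p - 1) / p))"
  shows "(\<lambda>z. \<Sum>n. of_real (c n) * G n z) \<in> hardy_upper p"
    "(\<lambda>t. \<Sum>n. of_real (c n) * g n t) \<in> Lp_space p"
    "upper_boundary_values (\<lambda>z. \<Sum>n. of_real (c n) * G n z) (\<lambda>t. \<Sum>n. of_real (c n) * g n t)"
    "AE t in lebesgue. summable (\<lambda>n. of_real (c n) * g n t)"
proof -
  have N0: "0 < N n" for n using N[of n] by simp
  have c0: "0 \<le> c n" for n using c by simp
  define b where "b n t = c n * (3 * bump (N n) (x n) t)" for n t
  have b0: "0 \<le> b n t" for n t using c0 bump_pos[OF N0] by (simp add: b_def less_imp_le)
  define E where "E t = (\<Sum>n. ennreal ((2 ^ Suc n * b n t) powr p))" for t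
  have "(\<integral>\<^sup>+t. E t \<partial>lebesgue) = (\<Sum>n. \<integral>\<^sup>+t. ennreal ((2 ^ Suc n * b n t) powr p) \<partial>lebesgue)"
    unfolding E_def b_def by (intro nn_integral_suminf measurable_completion) measurable
  also have "\<dots> = (\<Sum>n. ennreal (6 powr p * bump_mass p * ((1/2) powr p) ^ n))"
  proof (rule suminf_cong)
    fix n
    have nn: "0 \<le> 2 ^ Suc n * (c n * 3)" using c0 by simp
    have "(\<integral>\<^sup>+t. ennreal ((2 ^ Suc n * b n t) powr p) \<partial>lebesgue) =
       (\<integral>\<^sup>+t. ennreal ((2 ^ Suc n * (c n * 3)) powr p) * ennreal (bump (N n) (x n) t powr p) \<partial>lebesgue)"
    proof (rule nn_integral_cong)
      fix t
      have "2 ^ Suc n * b n t = (2 ^ Suc n * (c n * 3)) * bump (N n) (x n) t" by (simp add: b_def)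
      then have "(2 ^ Suc n * b n t) powr p = (2 ^ Suc n * (c n * 3)) powr p * bump (N n) (x n) t powr p"
        using nn bump_pos[OF N0] by (simp only: powr_mult)
      then show "ennreal ((2 ^ Suc n * b n t) powr p) = ennreal ((2 ^ Suc n * (c n * 3)) powr p) * ennreal (bump (N n) (x n) t powr p)"
        by (simp only: ennreal_mult[OF powr_ge_zero powr_ge_zero])
    qed
    also have "\<dots> = ennreal ((2 ^ Suc n * (c n * 3)) powr p) * ennreal (N n powr (p - 1) * bump_mass p)"
      using nn_integral_bump[OF p N0, of n "x n"]
      by (subst nn_integral_cmult) (auto intro!: measurable_completion)
    also have "\<dots> = ennreal ((2 ^ Suc n * (c n * 3)) powr p * (N n powr (p - 1) * bump_mass p))"
      by (simp only: ennreal_mult[OF powr_ge_zero mult_nonneg_nonneg[OF powr_ge_zero bump_mass_nonneg]])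
    also have "(2 ^ Suc n * (c n * 3)) powr p * (N n powr (p - 1) * bump_mass p) = 6 powr p * bump_mass p * ((1/2) powr p) ^ n"
    proof -
      have "2 ^ Suc n * (c n * 3) = 6 * (1/2) ^ n * N n powr (- ((p - 1) / p))"
        by (simp add: c power_divide field_simps flip: power_mult_distrib)
      then have "(2 ^ Suc n * (c n * 3)) powr p = 6 powr p * ((1/2) ^ n) powr p * (N n powr (- ((p - 1) / p))) powr p"
        by (simp add: powr_mult)
      also have "(N n powr (- ((p - 1) / p))) powr p = N n powr (- (p - 1))"
        using p by (simp add: powr_powr)
      also have "((1/2 :: real) ^ n) powr p = ((1/2) powr p) ^ n"
        by (simp add: powr_powr mult.commute flip: powr_realpow)
      finally show ?thesis using N0[of n] by (simp add: flip: powr_add)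
    qed
    finally show "(\<integral>\<^sup>+t. ennreal ((2 ^ Suc n * b n t) powr p) \<partial>lebesgue) = ennreal (6 powr p * bump_mass p * ((1/2) powr p) ^ n)" .
  qed
  also have "\<dots> < \<infinity>"
  proof -
    have "(1/2 :: real) powr p < 1 powr p" using p by (intro powr_less_mono2) auto
    then have "summable (\<lambda>n. 6 powr p * bump_mass p * ((1/2) powr p) ^ n)"
      by (intro summable_mult summable_geometric) simp
    then show ?thesis by (subst suminf_ennreal2) (auto simp: bump_mass_nonneg)
  qed
  finally have E: "(\<integral>\<^sup>+t. E t \<partial>lebesgue) < \<infinity>" .
  have Em: "E \<in> borel_measurable lebesgue"
    unfolding E_def b_def by (rule measurable_completion) measurable
  have half: "(\<lambda>n. (1/2 :: real) ^ Suc n) sums 1" by (rule power_half_series)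
  have term_le: "b n t \<le> e powr (1 / p) * (1/2) ^ Suc n" if e: "E t = ennreal e" "0 \<le> e" for n t e
  proof -
    have "ennreal ((2 ^ Suc n * b n t) powr p) \<le> (\<Sum>i\<in>{n}. ennreal ((2 ^ Suc i * b i t) powr p))" by simp
    also have "\<dots> \<le> E t" unfolding E_def by (rule sum_le_suminf) auto
    finally have "(2 ^ Suc n * b n t) powr p \<le> e" using e by (simp add: ennreal_le_iff)
    then have "((2 ^ Suc n * b n t) powr p) powr (1 / p) \<le> e powr (1 / p)"
      using p by (intro powr_mono2) auto
    then have "2 ^ Suc n * b n t \<le> e powr (1 / p)" using p b0[of n t] by (simp add: powr_powr)
    then show ?thesis by (simp add: field_simps)
  qed
  have bsum: "norm (suminf a) powr p \<le> e" "summable a"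
    if e: "E t = ennreal e" "0 \<le> e" and a: "\<And>n. norm (a n) \<le> b n t" for t e and a :: "nat \<Rightarrow> complex"
  proof -
    have s1: "(\<lambda>n. e powr (1 / p) * (1/2) ^ Suc n) sums (e powr (1 / p) * 1)" by (rule sums_mult[OF half])
    have le: "norm (a n) \<le> e powr (1 / p) * (1/2) ^ Suc n" for n using a[of n] term_le[OF e, of n] by linarith
    have sn: "summable (\<lambda>n. norm (a n))"
      by (rule summable_comparison_test'[OF sums_summable[OF s1], of 0]) (use le in auto)
    then show "summable a" by (rule summable_norm_cancel)
    have "norm (suminf a) \<le> (\<Sum>n. e powr (1 / p) * (1/2) ^ Suc n)"
      by (rule order_trans[OF summable_norm[OF sn] suminf_le[OF le sn sums_summable[OF s1]]])
    then have "norm (suminf a) \<le> e powr (1 / p)" using sums_unique[OF s1] by simp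
    then have "norm (suminf a) powr p \<le> (e powr (1 / p)) powr p" using p by (intro powr_mono2) auto
    then show "norm (suminf a) powr p \<le> e" using p e by (simp add: powr_powr)
  qed
  have bG: "norm (of_real (c n) * G n (Complex t s)) \<le> b n t" if "0 < s" for n t s
    using mult_left_mono[OF bump[of "Complex t s" n] c0[of n]] that c0[of n] by (simp add: norm_mult b_def)
  let ?F = "\<lambda>z. \<Sum>n. of_real (c n) * G n z"
  have "?F holomorphic_on upper_half_plane"
  proof (rule holomorphic_uniform_sequence)
    show "open upper_half_plane" by (rule open_upper_half_plane)
    show "(\<lambda>z. \<Sum>i<n. of_real (c i) * G i z) holomorphic_on upper_half_plane" for n
      using G by (intro holomorphic_intros) auto
    show "\<exists>d>0. cball z d \<subseteq> upper_half_plane \<and>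
        uniform_limit (cball z d) (\<lambda>n z. \<Sum>i<n. of_real (c i) * G i z) ?F sequentially"
      if z: "z \<in> upper_half_plane" for z
    proof -
      define d where "d = Im z / 2"
      have d: "0 < d" using z by (simp add: d_def upper_half_plane_def)
      have im': "d \<le> Im w" if "w \<in> cball z d" for w
        using that abs_Im_le_cmod[of "z - w"] by (auto simp: d_def dist_norm)
      have "uniform_limit (cball z d) (\<lambda>n z. \<Sum>i<n. of_real (c i) * G i z) ?F sequentially"
      proof (rule Weierstrass_m_test)
        show "summable (\<lambda>n. (1/4) ^ n * (2 / d))" by (intro summable_mult2 summable_geometric) simp
        fix n w assume w: "w \<in> cball z d"
        have "N n powr (- ((p - 1) / p)) \<le> N n powr 0" using p N by (intro powr_mono) auto
        then have "c n \<le> (1/4) ^ n * 1" unfolding c using N0[of n] by (intro mult_left_mono) auto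
        moreover have "norm (G n w) \<le> 2 / d"
          using im[of w n] im'[OF w] d by (intro order_trans[OF im divide_left_mono]) (auto intro!: mult_pos_pos)
        ultimately show "norm (of_real (c n) * G n w) \<le> (1/4) ^ n * (2 / d)"
          using mult_mono[of "c n" "(1/4) ^ n" "norm (G n w)" "2 / d"] c0[of n] by (simp add: norm_mult)
      qed
      moreover have "cball z d \<subseteq> upper_half_plane" using im' d by (force simp: upper_half_plane_def)
      ultimately show ?thesis using d by blast
    qed
  qed
  then show "?F \<in> hardy_upper p"
  proof (rule hardy_upper_dominated[OF _ E])
    fix t s :: real assume s: "0 < s"
    show "ennreal (norm (?F (Complex t s)) powr p) \<le> E t"
    proof (cases "E t")
      case (real e)
      then show ?thesis using bsum(1)[OF real(2,1) bG[OF s]] by (simp add: ennreal_leI)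
    qed simp
  qed
  have "AE t in lebesgue. E t \<noteq> \<infinity>" using Em E by (intro nn_integral_PInf_AE) auto
  moreover have "AE t in lebesgue. \<forall>n. ((\<lambda>y. G n (Complex t y)) \<longlongrightarrow> g n t) (at_right 0)"
    using bv by (simp add: AE_all_countable upper_boundary_values_def)
  ultimately have key: "AE t in lebesgue. ennreal (norm (\<Sum>n. of_real (c n) * g n t) powr p) \<le> E t \<and>
     summable (\<lambda>n. of_real (c n) * g n t) \<and>
     ((\<lambda>y. ?F (Complex t y)) \<longlongrightarrow> (\<Sum>n. of_real (c n) * g n t)) (at_right 0)"
  proof eventually_elim
    case (elim t)
    then obtain e where e: "E t = ennreal e" "0 \<le> e" by (cases "E t") auto
    have lim: "((\<lambda>y. of_real (c n) * G n (Complex t y)) \<longlongrightarrow> of_real (c n) * g n t) (at_right 0)" for n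
      using elim by (intro tendsto_intros) auto
    have bg: "norm (of_real (c n) * g n t) \<le> b n t" for n
      by (rule tendsto_upperbound[OF tendsto_norm[OF lim]])
         (auto intro!: eventually_at_right_less[THEN eventually_mono] bG simp del: of_real_mult norm_mult)
    have "((\<lambda>y. ?F (Complex t y)) \<longlongrightarrow> (\<Sum>n. of_real (c n) * g n t)) (at_right 0)"
    proof -
      have "eventually (\<lambda>y. y \<in> {0<..}) (at_right (0::real))" by (simp add: eventually_at_right_less)
      then have ev: "\<forall>\<^sub>F (n, y) in at_top \<times>\<^sub>F at_right 0. norm (of_real (c n) * G n (Complex t y)) \<le> e powr (1 / p) * (1/2) ^ Suc n"
        unfolding eventually_prod_filter
        by (intro exI[of _ "\<lambda>_. True"] exI[of _ "\<lambda>y. y \<in> {0<..}"])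
           (auto intro!: order_trans[OF bG term_le[OF e]] simp del: power_Suc)
      have "summable (\<lambda>n. e powr (1 / p) * (1/2) ^ Suc n)"
        using sums_summable[OF sums_mult[OF half]] .
      from tannerys_theorem[OF lim ev this] show ?thesis by simp
    qed
    then show ?case using bsum[OF e bg] e by (simp add: ennreal_leI)
  qed
  show "(\<lambda>t. \<Sum>n. of_real (c n) * g n t) \<in> Lp_space p"
  proof (rule Lp_space_dominated[OF _ E])
    show "(\<lambda>t. \<Sum>n. of_real (c n) * g n t) \<in> borel_measurable borel"
      using g by measurable
  qed (use key in \<open>auto elim: eventually_mono\<close>)
  show "upper_boundary_values ?F (\<lambda>t. \<Sum>n. of_real (c n) * g n t)"
    unfolding upper_boundary_values_def using key by (auto elim: eventually_mono)
  show "AE t in lebesgue. summable (\<lambda>n. of_real (c n) * g n t)"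
    using key by (auto elim: eventually_mono)
qed

lemma hardy_lower_reflect:
  assumes "F \<in> hardy_upper p"
  shows "(\<lambda>z. cnj (F (cnj z))) \<in> hardy_lower p"
proof -
  obtain M where M: "\<And>y. 0 < y \<Longrightarrow> (\<integral>\<^sup>+x. ennreal (norm (F (Complex x y)) powr p) \<partial>lebesgue) \<le> ennreal M"
    and hol: "F holomorphic_on upper_half_plane" using hardy_upperE[OF assms] by blast
  have "cnj \<circ> F \<circ> cnj holomorphic_on lower_half_plane"
    by (rule holomorphic_on_compose_cnj_cnj)
       (auto simp: upper_half_plane_def lower_half_plane_def open_halfspace_Im_lt intro: holomorphic_on_subset[OF hol])
  moreover have "(SUP y\<in>{..<0}. \<integral>\<^sup>+ x. ennreal (norm (cnj (F (cnj (Complex x y)))) powr p) \<partial>lebesgue) \<le> ennreal M"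
  proof (rule SUP_least)
    fix y :: real assume "y \<in> {..<0}"
    then show "(\<integral>\<^sup>+ x. ennreal (norm (cnj (F (cnj (Complex x y)))) powr p) \<partial>lebesgue) \<le> ennreal M"
      using M[of "- y"] by (simp add: complex_cnj)
  qed
  ultimately show ?thesis by (auto simp: hardy_lower_def o_def intro: le_less_trans)
qed

lemma lower_boundary_values_reflect:
  assumes "upper_boundary_values F f"
  shows "lower_boundary_values (\<lambda>z. cnj (F (cnj z))) (\<lambda>t. cnj (f t))"
  using assms unfolding upper_boundary_values_def lower_boundary_values_def
proof eventually_elim
  case (elim x)
  have "filterlim uminus (at_right (0::real)) (at_left 0)"
    by (simp add: filterlim_def filtermap_filtermap at_right_minus)
  from tendsto_cnj[OF filterlim_compose[OF elim this]] show ?case by (simp add: complex_cnj)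
qed

section \<open>Reproducing kernels of the model space\<close>

text \<open>For \<open>p = 2\<close> this is, up to a constant factor, the reproducing kernel of
  the model space at \<open>w\<close>.\<close>

definition model_kernel :: "(complex \<Rightarrow> complex) \<Rightarrow> complex \<Rightarrow> complex \<Rightarrow> complex" where
  "model_kernel \<theta> w z = (1 - cnj (\<theta> w) * \<theta> z) / (z - cnj w)"

text \<open>On the real line, where \<open>\<theta> * cnj \<theta> = 1\<close>, multiplying the
  conjugate of this function by \<open>\<theta>\<close> gives the kernel at \<open>w\<close>. The
  derivative fills the removable singularity.\<close>

definition difference_quotient :: "(complex \<Rightarrow> complex) \<Rightarrow> complex \<Rightarrow> complex \<Rightarrow> complex" where
  "difference_quotient \<theta> w z = (if z = w then deriv \<theta> w else (\<theta> z - \<theta> w) / (z - w))"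

lemma diff_cnj_nonzero: "0 < Im w \<Longrightarrow> 0 \<le> Im z \<Longrightarrow> z - cnj w \<noteq> 0"
  by (auto simp: complex_eq_iff)

lemma norm_model_kernel_le:
  assumes le1: "\<And>z. 0 < Im z \<Longrightarrow> norm (\<theta> z) \<le> 1"
    and "0 < Im w" "0 < Im z" "0 < d" "d \<le> norm (z - cnj w)"
  shows "norm (model_kernel \<theta> w z) \<le> 2 / d"
proof -
  have "norm (1 - cnj (\<theta> w) * \<theta> z) \<le> 1 + norm (\<theta> w) * norm (\<theta> z)"
    using norm_triangle_ineq4[of 1 "cnj (\<theta> w) * \<theta> z"] by (simp add: norm_mult)
  also have "\<dots> \<le> 1 + 1 * 1" using le1 assms by (intro add_left_mono mult_mono) auto
  finally show ?thesis
    unfolding model_kernel_def norm_divide using assms by (intro frac_le) auto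
qed

lemma holomorphic_model_kernel:
  assumes hol: "\<theta> holomorphic_on upper_half_plane" and w: "0 < Im w"
  shows "model_kernel \<theta> w holomorphic_on upper_half_plane"
  unfolding model_kernel_def using diff_cnj_nonzero[OF w] hol
  by (intro holomorphic_intros) (auto simp: upper_half_plane_def)

lemma holomorphic_difference_quotient:
  assumes hol: "\<theta> holomorphic_on upper_half_plane" and w: "0 < Im w"
  shows "difference_quotient \<theta> w holomorphic_on upper_half_plane"
  unfolding difference_quotient_def using w
  by (intro pole_lemma[OF hol], subst interior_open[OF open_upper_half_plane]) (simp add: upper_half_plane_def)

text \<open>Away from \<open>w\<close> this is the Schwarz-Pick inequality, at \<open>w\<close>
  the limit of it. Thus every majorant of the kernel also serves for its counterpart in the lower
  half-plane.\<close>

lemma norm_difference_quotient_le_model_kernel: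
  assumes hol: "\<theta> holomorphic_on upper_half_plane"
    and le1: "\<And>z. 0 < Im z \<Longrightarrow> norm (\<theta> z) \<le> 1" and w: "0 < Im w" and z: "0 < Im z"
  shows "norm (difference_quotient \<theta> w z) \<le> norm (model_kernel \<theta> w z)"
proof -
  have ne: "norm (difference_quotient \<theta> w v) \<le> norm (model_kernel \<theta> w v)" if v: "0 < Im v" "v \<noteq> w" for v
  proof -
    have "0 < norm (v - w)" "0 < norm (v - cnj w)" using v diff_cnj_nonzero[OF w, of v] by auto
    then show ?thesis
      using Schwarz_Pick_upper_half_plane[OF hol le1 w v(1)] v
      by (simp add: difference_quotient_def model_kernel_def norm_divide divide_le_eq field_simps)
  qed
  show ?thesis
  proof (cases "z = w")
    case True
    have "isCont (difference_quotient \<theta> w) w" "isCont (model_kernel \<theta> w) w"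
      using w continuous_on_interior[OF holomorphic_on_imp_continuous_on[OF holomorphic_difference_quotient[OF hol w]]]
        continuous_on_interior[OF holomorphic_on_imp_continuous_on[OF holomorphic_model_kernel[OF hol w]]]
      by (simp_all add: interior_open[OF open_upper_half_plane]) (simp_all add: upper_half_plane_def)
    then have "((\<lambda>v. norm (difference_quotient \<theta> w v)) \<longlongrightarrow> norm (difference_quotient \<theta> w w)) (at w)" "((\<lambda>v. norm (model_kernel \<theta> w v)) \<longlongrightarrow> norm (model_kernel \<theta> w w)) (at w)"
      by (auto simp: isCont_def intro: tendsto_norm)
    moreover have "eventually (\<lambda>v. norm (difference_quotient \<theta> w v) \<le> norm (model_kernel \<theta> w v)) (at w)"
    proof -
      have "eventually (\<lambda>v. v \<in> upper_half_plane - {w}) (at w)"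
        using open_upper_half_plane w by (intro eventually_at_in_open) (auto simp: upper_half_plane_def)
      then show ?thesis by eventually_elim (auto intro: ne simp: upper_half_plane_def)
    qed
    ultimately have "norm (difference_quotient \<theta> w w) \<le> norm (model_kernel \<theta> w w)" by (intro tendsto_le[OF trivial_limit_at]) auto
    then show ?thesis using True by simp
  qed (use ne z in auto)
qed

text \<open>The gliding hump is run over the kernels at all \<open>w\<close>, evaluated at all
  \<open>z\<close>, with the exponent \<open>(p - 1) / p\<close> for which
  \<open>hardy_upper_series\<close> applies. The resulting element of the model space has an
  unbounded extension and hence an unbounded boundary function.\<close>

theorem model_space_subset_Hinf_plus_imp_bounded:
  assumes p: "1 < p" and \<theta>: "inner_function \<theta>" and sub: "model_space p \<theta> \<subseteq> Hinf_plus"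
  shows "\<exists>C. \<forall>w. 0 < Im w \<longrightarrow> (1 - (norm (\<theta> w))\<^sup>2) / Im w \<le> C"
proof (rule ccontr)
  assume "\<not> ?thesis"
  then have unb: "\<exists>w. 0 < Im w \<and> C < (1 - (norm (\<theta> w))\<^sup>2) / Im w" for C by (meson not_le)
  have hol: "\<theta> holomorphic_on upper_half_plane" using \<theta> by (simp add: inner_function_def hardy_inf_upper_def)
  note le1 = inner_function_norm_le_1[OF \<theta>]
  let ?U = upper_half_plane and ?k = "model_kernel \<theta>" and ?Q = "difference_quotient \<theta>"
  have kle: "norm (?k w z) \<le> 2 / d" if "0 < Im w" "0 < Im z" "0 < d" "d \<le> norm (z - cnj w)" for w z d
    using norm_model_kernel_le[OF _ that] le1 by blast
  have Qk: "norm (?Q w z) \<le> norm (?k w z)" if "0 < Im w" "0 < Im z" for w z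
    using norm_difference_quotient_le_model_kernel[OF hol _ that] le1 by blast
  note khol = holomorphic_model_kernel[OF hol] and Qhol = holomorphic_difference_quotient[OF hol]
  have kT: "norm (?k w z) \<le> 2 / Im z" and kS: "norm (?k w z) \<le> 2 / Im w" if "0 < Im w" "0 < Im z" for w z
    using that abs_Im_le_cmod[of "z - cnj w"] by (auto intro!: kle)
  have r: "0 < (p - 1) / p" "(p - 1) / p < 1" using p by auto
  have hump: "\<exists>B. \<forall>z\<in>?U. norm (?k w z) \<le> B" if "w \<in> ?U" for w
    using kS that by (auto simp: upper_half_plane_def)
  have hump2: "\<exists>T. \<forall>w\<in>?U. norm (?k w z) \<le> T" if "z \<in> ?U" for z
    using kT that by (auto simp: upper_half_plane_def)
  have hump3: "\<exists>w\<in>?U. \<exists>z\<in>?U. B < norm (?k w z)" for B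
  proof -
    obtain w where w: "0 < Im w" "2 * \<bar>B\<bar> < (1 - (norm (\<theta> w))\<^sup>2) / Im w" using unb by blast
    define A where "A = (1 - (norm (\<theta> w))\<^sup>2) / Im w"
    have "1 - cnj (\<theta> w) * \<theta> w = of_real (1 - (norm (\<theta> w))\<^sup>2)" by (simp only: of_real_diff of_real_1 complex_norm_square mult.commute)
    then have "norm (?k w w) = \<bar>1 - (norm (\<theta> w))\<^sup>2\<bar> / (2 * Im w)"
      using w unfolding model_kernel_def norm_divide by (simp add: complex_diff_cnj norm_mult del: of_real_diff)
    also have "\<bar>1 - (norm (\<theta> w))\<^sup>2\<bar> / (2 * Im w) = (1 - (norm (\<theta> w))\<^sup>2) / Im w / 2"
      using le1[OF w(1)] by (simp add: power_le_one)
    finally have "norm (?k w w) = A / 2" by (simp only: A_def)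
    then have "B < norm (?k w w)" using w(2)[folded A_def] by linarith
    then show ?thesis using w by (auto simp: upper_half_plane_def)
  qed
  obtain w N where w: "\<And>n. w n \<in> ?U" and N: "\<And>n. 1 \<le> N n" and kN: "\<And>n z. z \<in> ?U \<Longrightarrow> norm (?k (w n) z) \<le> N n"
    and big: "\<And>B. \<exists>z\<in>?U. B < norm (\<Sum>n. of_real ((1/4) ^ n * N n powr (- ((p - 1) / p))) * ?k (w n) z)"
    using gliding_hump[of "(p - 1) / p" ?U ?U ?k, OF r hump hump2 hump3] by blast
  have w': "0 < Im (w n)" for n using w[of n] by (simp add: upper_half_plane_def)
  define c where "c n = (1/4) ^ n * N n powr (- ((p - 1) / p))" for n
  have kb: "norm (?k (w n) z) \<le> 3 * bump (N n) (Re (w n)) (Re z)" if z: "0 < Im z" for n z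
  proof -
    let ?T = "\<bar>Re z - Re (w n)\<bar>"
    have Nn: "1 \<le> N n" by (rule N)
    have den: "0 < 1 + N n * ?T" using Nn by (intro add_pos_nonneg) auto
    show ?thesis
    \<comment> \<open>The two bounds \<open>N n\<close> and \<open>2 / ?T\<close> coincide for
      \<open>N n * ?T = 2\<close>.\<close>
    proof (cases "N n * ?T \<le> 2")
      case True
      have "N n * (1 + N n * ?T) \<le> N n * 3" using True Nn by (intro mult_left_mono) auto
      then have "N n \<le> 3 * bump (N n) (Re (w n)) (Re z)" using den by (simp add: bump_def le_divide_eq mult.commute)
      then show ?thesis using kN[of z n] z by (simp add: upper_half_plane_def)
    next
      case False
      then have T: "0 < ?T" by (metis abs_ge_zero less_eq_real_def mult_zero_right not_le zero_less_numeral order_less_le)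
      have "?T \<le> norm (z - cnj (w n))" using abs_Re_le_cmod[of "z - cnj (w n)"] by simp
      then have "norm (?k (w n) z) \<le> 2 / ?T" by (rule kle[OF w' z T])
      also have "\<dots> \<le> 3 * bump (N n) (Re (w n)) (Re z)"
        using False den T by (simp add: bump_def divide_le_eq le_divide_eq field_simps)
      finally show ?thesis .
    qed
  qed
  obtain u where u: "u \<in> borel_measurable borel" "upper_boundary_values \<theta> u"
    using \<theta> borel_boundary_values[OF hol] unfolding inner_function_def by blast
  note u1 = AE_boundary_unimodular[OF \<theta> u(2)]
  define kb' where "kb' n t = (1 - cnj (\<theta> (w n)) * u t) / (of_real t - cnj (w n))" for n t
  define Qb where "Qb n t = (u t - \<theta> (w n)) / (of_real t - w n)" for n t
  have tnz: "of_real t - w n \<noteq> 0" "of_real t - cnj (w n) \<noteq> 0" for t n using w'[of n] by (auto simp: complex_eq_iff)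
  have kbv: "upper_boundary_values (?k (w n)) (kb' n)" for n
    using u(2) unfolding upper_boundary_values_def
  proof eventually_elim
    case (elim t)
    then show ?case unfolding model_kernel_def kb'_def using tnz by (intro tendsto_intros tendsto_vertical)
  qed
  have Qbv: "upper_boundary_values (?Q (w n)) (Qb n)" for n
    using u(2) unfolding upper_boundary_values_def
  proof eventually_elim
    case (elim t)
    have "((\<lambda>y. (\<theta> (Complex t y) - \<theta> (w n)) / (Complex t y - w n)) \<longlongrightarrow> Qb n t) (at_right 0)"
      unfolding Qb_def using elim tnz by (intro tendsto_intros tendsto_vertical)
    moreover have "eventually (\<lambda>y. (\<theta> (Complex t y) - \<theta> (w n)) / (Complex t y - w n) = ?Q (w n) (Complex t y)) (at_right 0)"
    proof -
      have "eventually (\<lambda>y. y \<in> {0<..<Im (w n)}) (at_right 0)" by (rule eventually_at_right_real[OF w'])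
      then show ?thesis by eventually_elim (auto simp: difference_quotient_def complex_eq_iff)
    qed
    ultimately show ?case by (rule Lim_transform_eventually)
  qed
  have kbm: "kb' n \<in> borel_measurable borel" and Qbm: "Qb n \<in> borel_measurable borel" for n
    unfolding kb'_def[abs_def] Qb_def[abs_def] using u(1) by measurable
  define F where "F z = (\<Sum>n. of_real (c n) * ?k (w n) z)" for z
  define f where "f t = (\<Sum>n. of_real (c n) * kb' n t)" for t
  define R where "R z = (\<Sum>n. of_real (c n) * ?Q (w n) z)" for z
  define h where "h t = (\<Sum>n. of_real (c n) * Qb n t)" for t
  have Fs: "F \<in> hardy_upper p" "f \<in> Lp_space p" "upper_boundary_values F f"
    using hardy_upper_series[OF p N khol[OF w'] kb kT[OF w'] kbv kbm c_def]
    by (simp_all add: F_def[abs_def] f_def[abs_def])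
  have Rs: "R \<in> hardy_upper p" "h \<in> Lp_space p" "upper_boundary_values R h"
      "AE t in lebesgue. summable (\<lambda>n. of_real (c n) * Qb n t)"
    using hardy_upper_series[OF p N Qhol[OF w'] order_trans[OF Qk[OF w'] kb] order_trans[OF Qk[OF w'] kT[OF w']] Qbv Qbm c_def]
    by (simp_all add: R_def[abs_def] h_def[abs_def])
  have "(\<lambda>t. cnj (h t)) \<in> Lp_space p"
    using Rs(2) by (auto simp: Lp_space_def intro: borel_measurable_continuous_on[OF continuous_on_cnj[OF continuous_on_id]])
  then have hm: "(\<lambda>t. cnj (h t)) \<in> Hp_minus p"
    using hardy_lower_reflect[OF Rs(1)] lower_boundary_values_reflect[OF Rs(3)] by (auto simp: Hp_minus_def)
  have "AE t in lebesgue. f t = u t * cnj (h t)"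
    using Rs(4) u1
  proof eventually_elim
    case (elim t)
    have tm: "u t * cnj (of_real (c n) * Qb n t) = of_real (c n) * kb' n t" for n
    proof -
      have "u t * cnj (u t) = 1" using elim(2) by (simp flip: complex_norm_square)
      then have "u t * (cnj (u t) - cnj (\<theta> (w n))) = 1 - cnj (\<theta> (w n)) * u t" by (simp add: algebra_simps)
      then show ?thesis by (simp add: Qb_def kb'_def mult.left_commute)
    qed
    have "bounded_linear (\<lambda>v. u t * cnj v)"
      by (rule bounded_linear_const_mult[OF bounded_linear_cnj])
    from bounded_linear.suminf[OF this elim(1)]
    have "u t * cnj (h t) = (\<Sum>n. u t * cnj (of_real (c n) * Qb n t))" by (simp add: h_def)
    also have "\<dots> = f t" unfolding f_def by (simp only: tm)
    finally show ?case by (rule sym)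
  qed
  then have "f \<in> model_space p \<theta>"
    using Fs hm u(2) by (auto simp: model_space_def boundary_mult_def Hp_plus_def)
  then have "f \<in> Linf_space" using sub by (auto simp: Hinf_plus_def)
  then obtain C where C: "AE t in lebesgue. norm (f t) \<le> C" by (auto simp: Linf_space_def)
  then have C': "AE t in lebesgue. norm (f t) \<le> \<bar>C\<bar>" by (rule eventually_mono) linarith
  obtain z where z: "z \<in> ?U" "8 * bump_mass 2 / (2 * pi) * \<bar>C\<bar> < norm (F z)"
    using big unfolding F_def c_def by blast
  have "norm (F z) \<le> 8 * bump_mass 2 / (2 * pi) * \<bar>C\<bar>"
    using z(1) by (intro hardy_bounded_by_boundary_values[OF p Fs C']) (auto simp: upper_half_plane_def)
  then show False using z by simp
qed

section \<open>Bounded model spaces\<close>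

theorem theorem4p3:
  fixes p :: real and \<theta> :: "complex \<Rightarrow> complex"
  assumes "1 < p" and "inner_function \<theta>"
  shows "model_space p \<theta> \<subseteq> Hinf_plus \<longleftrightarrow>
    (SUP w\<in>upper_half_plane. ereal ((1 - (norm (\<theta> w))\<^sup>2) / Im w)) < \<infinity>"
proof
  assume "model_space p \<theta> \<subseteq> Hinf_plus"
  then obtain C where "\<And>w. 0 < Im w \<Longrightarrow> (1 - (norm (\<theta> w))\<^sup>2) / Im w \<le> C"
    using model_space_subset_Hinf_plus_imp_bounded[OF assms] by blast
  then have "(SUP w\<in>upper_half_plane. ereal ((1 - (norm (\<theta> w))\<^sup>2) / Im w)) \<le> ereal C"
    by (intro SUP_least) (simp add: upper_half_plane_def)
  then show "(SUP w\<in>upper_half_plane. ereal ((1 - (norm (\<theta> w))\<^sup>2) / Im w)) < \<infinity>"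
    by (rule le_less_trans) simp
next
  assume fin: "(SUP w\<in>upper_half_plane. ereal ((1 - (norm (\<theta> w))\<^sup>2) / Im w)) < \<infinity>"
  then obtain C where C: "(SUP w\<in>upper_half_plane. ereal ((1 - (norm (\<theta> w))\<^sup>2) / Im w)) < ereal C"
    using less_PInf_Ex_of_nat by auto
  show "model_space p \<theta> \<subseteq> Hinf_plus"
  proof (rule model_space_subset_Hinf_plus_if_bounded[OF assms])
    fix w assume w: "0 < Im w"
    then have "ereal ((1 - (norm (\<theta> w))\<^sup>2) / Im w) \<le> (SUP w\<in>upper_half_plane. ereal ((1 - (norm (\<theta> w))\<^sup>2) / Im w))"
      by (intro SUP_upper) (simp add: upper_half_plane_def)
    with C have "ereal ((1 - (norm (\<theta> w))\<^sup>2) / Im w) < ereal C" by (rule le_less_trans[rotated])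
    then show "1 - (norm (\<theta> w))\<^sup>2 \<le> C * Im w" using w by (simp add: divide_less_eq)
  qed
qed

end
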